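(* Let $k\ge4$ be an even integer and let $\varphi_k(\tau)=\sum_{n=1}^\infty\frac{\sigma_{k-1}(n)}{n^{k+1}}e^{2\pi i n\tau}$ for $\tau\in\mathbb{H}$. Let $C_k=-\frac{k!\,2k}{(2i\pi)^{k+1}B_k}$. For every $\alpha\in\mathbb{H}$ there exist a polynomial $P_{k,\alpha}(\tau)$ in $\tau$ of degree at most $k+1$ and a polynomial $Q_{k,\alpha}(t,\tau)$ in $t$ and $\tau$ of degree at most $k+1$, both depending on $\alpha$, such that for all $\tau\in\mathbb{H}$, $$\varphi_k(\tau)=\tau^{k+2}\varphi_k\Big(-\frac1\tau\Big)-\frac{k}{C_k}\tau\,\mathrm{Log}(\tau)+P_{k,\alpha}(\tau)+\int_\alpha^\tau Q_{k,\alpha}(t,\tau)\varphi_k\Big(-\frac1t\Big)dt.$$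
   Context: $\mathbb{H}$ is the upper half plane, $\sigma_{k-1}(n)=\sum_{d\mid n}d^{k-1}$, $B_k$ is the $k$-th Bernoulli number, and $\mathrm{Log}$ is the principal branch of the complex logarithm. *)

theory Defs
  imports
    "HOL-Complex_Analysis.Complex_Analysis"
    "HOL-Computational_Algebra.Computational_Algebra"
begin

definition upper_half_plane :: "complex set" where
  "upper_half_plane = {\<tau>. Im \<tau> > 0}"

definition divisor_sigma :: "nat \<Rightarrow> nat \<Rightarrow> nat" where
  "divisor_sigma m n = (\<Sum>d | d dvd n. d ^ m)"

(* Exponential generating function X / (exp X - 1), hence the convention B_1 = -1/2. *)
definition bernoulli :: "nat \<Rightarrow> real" where
  "bernoulli n = fact n * fps_nth (fps_X / (fps_exp 1 - 1)) n"

(* The summation index n starts at 0, so Suc n plays the role of the index starting at 1. *)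
definition phi :: "nat \<Rightarrow> complex \<Rightarrow> complex" where
  "phi k \<tau> = (\<Sum>n. of_nat (divisor_sigma (k - 1) (Suc n)) / of_nat (Suc n) ^ (k + 1)
                     * exp (2 * of_real pi * \<i> * of_nat (Suc n) * \<tau>))"

definition C_const :: "nat \<Rightarrow> complex" where
  "C_const k = - (fact k * (2 * of_nat k))
                 / ((2 * \<i> * of_real pi) ^ (k + 1) * of_real (bernoulli k))"

(* A polynomial Q in two variables t and tau is represented as a polynomial in tau
   whose coefficients are polynomials in t. *)
definition poly2 :: "complex poly poly \<Rightarrow> complex \<Rightarrow> complex \<Rightarrow> complex" where
  "poly2 Q t \<tau> = poly (poly Q [:\<tau>:]) t"

(* Total degree in both variables (0 for Q = 0). Indices i with coeff Q i = 0 contribute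
   only i \<le> degree Q, which never exceeds the contribution of the leading coefficient. *)
definition total_degree :: "complex poly poly \<Rightarrow> nat" where
  "total_degree Q = Max ((\<lambda>i. i + degree (coeff Q i)) ` {..degree Q})"

end

(* The (k+1)-st derivative of phi_k is, up to a constant, the divisor series S of the Eisenstein
   series E_k. By Bol's identity the (k+1)-st derivative of t^k phi_k(-1/t) is t^(-k-2) times that
   of phi_k at -1/t, so the modularity of E_k says that phi_k and
     tau^(k+2) phi_k(-1/tau) - (k / C_k) tau Log tau + integral of Q(t,tau) phi_k(-1/t)
   have (k+1)-st derivatives differing by a constant, once Q makes the lower derivatives cancel.
   The difference is therefore a polynomial of degree at most k+1. *)

theory Submission
  imports Defs
begin

section \<open>Derivatives on the upper half-plane\<close>

text \<open>Modularity holds for S minus the constant B_k/(2k), not for S alone. After Bol's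
  identity this constant leaves a multiple of \<tau>^(-k), which is the (k+1)-st derivative of
  \<tau> Log \<tau> up to the factor -(k-1)!; the coefficient k / C_k is the one that absorbs it.
  Bol's identity brings the weight k+2, two more than the weight of E_k: hence \<tau>^(k+2) instead
  of \<tau>^k, and the extra \<tau>^2 creates the lower derivatives that the kernel has to remove.
  As \<tau> is both an endpoint and a variable of the integrand, the integral is split into fixed
  primitives vanishing at \<alpha>, one of them multiplied by \<tau>. Modularity itself comes from
  an absolutely convergent lattice sum, which inversion merely permutes. Passing from that sum to S
  takes the Lipschitz formula for the rows off the origin and zeta(k) for the row through it. Both
  have one source, the cotangent as a difference of Digamma values: differentiated in the half-plane
  it yields the former, expanded at 0 the latter.\<close>

lemma open_upper_half_plane: "open upper_half_plane"
  unfolding upper_half_plane_def by (rule open_halfspace_Im_gt)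

lemma convex_upper_half_plane: "convex upper_half_plane"
  unfolding upper_half_plane_def by (rule convex_halfspace_Im_gt)

lemma upper_half_plane_nz [simp]: "0 \<notin> upper_half_plane"
  by (simp add: upper_half_plane_def)

lemma minus_inverse_upper_half_plane:
  assumes "\<tau> \<in> upper_half_plane"
  shows "- 1 / \<tau> \<in> upper_half_plane"
proof -
  have "Im \<tau> > 0" using assms by (simp add: upper_half_plane_def)
  moreover have "(Re \<tau>)\<^sup>2 + (Im \<tau>)\<^sup>2 > 0"
    using \<open>Im \<tau> > 0\<close> by (simp add: sum_power2_gt_zero_iff)
  ultimately show ?thesis
    by (simp add: upper_half_plane_def Im_divide)
qed

section \<open>Power series in q = exp(2 pi i \<tau>) without constant term\<close>

definition qseries :: "(nat \<Rightarrow> complex) \<Rightarrow> complex \<Rightarrow> complex" where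
  "qseries a \<tau> = (\<Sum>n. a n * exp (2 * of_real pi * \<i> * of_nat (Suc n) * \<tau>))"

text \<open>This says that the radius of convergence is at least 1. The property survives
  multiplication of the coefficients by n, so one hypothesis covers all derivatives.\<close>

definition disc_summable :: "(nat \<Rightarrow> complex) \<Rightarrow> bool" where
  "disc_summable a \<longleftrightarrow> (\<forall>x. norm x < 1 \<longrightarrow> summable (\<lambda>n. a n * x ^ n))"

lemma exp_upper_half_plane:
  assumes "\<tau> \<in> upper_half_plane"
  shows "norm (exp (2 * of_real pi * \<i> * \<tau>)) < 1"
  using assms by (simp add: upper_half_plane_def)

lemma exp_of_nat_Suc:
  "exp (2 * of_real pi * \<i> * of_nat (Suc n) * \<tau>) = exp (2 * of_real pi * \<i> * \<tau>) ^ Suc n"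
  by (subst exp_of_nat_mult [symmetric]) (simp only: mult_ac)

lemma disc_summable_bounded:
  assumes "\<And>n. norm (a n) \<le> 1"
  shows "disc_summable a"
  unfolding disc_summable_def
proof (intro allI impI)
  fix x :: complex assume x: "norm x < 1"
  show "summable (\<lambda>n. a n * x ^ n)"
  proof (rule summable_comparison_test')
    show "summable (\<lambda>n. norm x ^ n)" using x by simp
    show "norm (a n * x ^ n) \<le> norm x ^ n" for n
      using mult_right_mono [OF assms [of n], of "norm x ^ n"] by (simp add: norm_mult norm_power)
  qed
qed

lemma disc_summable_cmult:
  assumes "disc_summable a"
  shows "disc_summable (\<lambda>n. c * a n)"
  using assms unfolding disc_summable_def by (auto simp: mult.assoc intro!: summable_mult)

text \<open>\<open>qseries\<close> starts at q^1, while the library theorems on power series start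
  at exponent 0; a zero coefficient in front reconciles the two.\<close>

lemma disc_summable_shift:
  assumes "disc_summable a" and "norm y < 1"
  shows "summable (\<lambda>n. (case n of 0 \<Rightarrow> 0 | Suc m \<Rightarrow> a m) * y ^ n)"
proof -
  have "summable (\<lambda>n. y * (a n * y ^ n))"
    using assms unfolding disc_summable_def by (intro summable_mult) auto
  then show ?thesis
    by (subst summable_Suc_iff [symmetric]) (simp add: mult_ac)
qed

text \<open>These are the coefficients of the formal derivative of the series with a zero put in
  front, and differentiation preserves the disc of convergence.\<close>

lemma disc_summable_Suc_mult:
  assumes "disc_summable a"
  shows "disc_summable (\<lambda>n. of_nat (Suc n) * a n)"
  unfolding disc_summable_def
proof (intro allI impI)
  fix x :: complex assume x: "norm x < 1"
  define c where "c = (\<lambda>n. case n of 0 \<Rightarrow> 0 | Suc m \<Rightarrow> a m)"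
  have "summable (\<lambda>n. c n * y ^ n)" if "norm y < 1" for y
    unfolding c_def by (rule disc_summable_shift [OF assms that])
  from termdiff_converges [of x 1 c, OF _ this] x
  show "summable (\<lambda>n. of_nat (Suc n) * a n * x ^ n)"
    by (simp add: diffs_def c_def)
qed

text \<open>A power series converging at some r with |q| < r < 1 converges absolutely at q.\<close>

lemma norm_summable_qseries:
  assumes a: "disc_summable a" and \<tau>: "\<tau> \<in> upper_half_plane"
  shows "summable (\<lambda>n. norm (a n * exp (2 * of_real pi * \<i> * of_nat (Suc n) * \<tau>)))"
proof -
  define q where "q = exp (2 * of_real pi * \<i> * \<tau>)"
  have q: "norm q < 1"
    using exp_upper_half_plane [OF \<tau>] by (simp add: q_def)
  then obtain r where r: "norm q < r" "r < 1" using dense by blast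
  have r': "norm (complex_of_real r) = r"
    using order.strict_trans1 [OF norm_ge_zero r(1)] by simp
  have "summable (\<lambda>n. norm (a n * q ^ n))"
    by (rule powser_insidea [of a "of_real r"]) (use a r r' in \<open>auto simp: disc_summable_def\<close>)
  then have "summable (\<lambda>n. norm (a n * q ^ n) * norm q)"
    by (rule summable_mult2)
  then show ?thesis
    unfolding exp_of_nat_Suc q_def [symmetric] by (simp add: norm_mult mult_ac)
qed

lemma summable_qseries:
  assumes "disc_summable a" and "\<tau> \<in> upper_half_plane"
  shows "summable (\<lambda>n. a n * exp (2 * of_real pi * \<i> * of_nat (Suc n) * \<tau>))"
  using norm_summable_qseries [OF assms] by (rule summable_norm_cancel)

text \<open>Chain rule through q. Termwise differentiation lowers each exponent by one, and the
  factor q in the derivative of q restores it.\<close>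

lemma has_field_derivative_qseries:
  assumes a: "disc_summable a" and \<tau>: "\<tau> \<in> upper_half_plane"
  shows "(qseries a has_field_derivative
           qseries (\<lambda>n. 2 * of_real pi * \<i> * of_nat (Suc n) * a n) \<tau>) (at \<tau>)"
proof -
  define q where "q = (\<lambda>z. exp (2 * of_real pi * \<i> * z))"
  define c where "c = (\<lambda>n. case n of 0 \<Rightarrow> 0 | Suc m \<Rightarrow> a m)"
  have c: "summable (\<lambda>n. c n * y ^ n)" if "norm y < 1" for y
    unfolding c_def by (rule disc_summable_shift [OF a that])
  have q: "norm (q z) < 1" if "z \<in> upper_half_plane" for z
    using exp_upper_half_plane [OF that] by (simp add: q_def)
  have eq: "(\<Sum>n. c n * q z ^ n) = qseries a z" if "z \<in> upper_half_plane" for z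
  proof -
    have "(\<Sum>n. c n * q z ^ n) = (\<Sum>n. c (Suc n) * q z ^ Suc n)"
      using suminf_split_head [OF c [OF q [OF that]]] by (simp add: c_def)
    then show ?thesis
      by (simp only: qseries_def exp_of_nat_Suc q_def) (simp add: c_def)
  qed
  obtain r where r: "norm (q \<tau>) < r" "r < 1" using q [OF \<tau>] dense by blast
  have "DERIV (\<lambda>x. \<Sum>n. c n * x ^ n) (q \<tau>) :> (\<Sum>n. diffs c n * q \<tau> ^ n)"
    by (rule termdiffs_strong [of c "of_real r"]) (use r order.strict_trans1 [OF norm_ge_zero r(1)] in \<open>auto intro!: c\<close>)
  moreover have "DERIV q \<tau> :> 2 * of_real pi * \<i> * q \<tau>"
    unfolding q_def by (auto intro!: derivative_eq_intros)
  ultimately have D: "DERIV (\<lambda>z. \<Sum>n. c n * q z ^ n) \<tau> :>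
      (\<Sum>n. diffs c n * q \<tau> ^ n) * (2 * of_real pi * \<i> * q \<tau>)"
    by (rule DERIV_chain2)
  have "summable (\<lambda>n. diffs c n * q \<tau> ^ n)"
    by (rule termdiff_converges [of _ 1]) (use q [OF \<tau>] c in auto)
  then have "(\<Sum>n. diffs c n * q \<tau> ^ n) * (2 * of_real pi * \<i> * q \<tau>) =
      (\<Sum>n. diffs c n * q \<tau> ^ n * (2 * of_real pi * \<i> * q \<tau>))"
    by (rule suminf_mult2)
  also have "\<dots> = qseries (\<lambda>n. 2 * of_real pi * \<i> * of_nat (Suc n) * a n) \<tau>"
    unfolding qseries_def
    by (rule suminf_cong, subst exp_of_nat_Suc) (simp add: diffs_def c_def q_def mult_ac)
  finally have "DERIV (\<lambda>z. \<Sum>n. c n * q z ^ n) \<tau> :>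
      qseries (\<lambda>n. 2 * of_real pi * \<i> * of_nat (Suc n) * a n) \<tau>"
    using D by simp
  then show ?thesis
    by (rule has_field_derivative_transform_within_open [OF _ open_upper_half_plane \<tau> eq])
qed

lemma holomorphic_qseries:
  assumes "disc_summable a"
  shows "qseries a holomorphic_on upper_half_plane"
  using has_field_derivative_qseries [OF assms]
  by (auto simp: holomorphic_on_open [OF open_upper_half_plane])

lemma disc_summable_power:
  assumes "disc_summable a"
  shows "disc_summable (\<lambda>n. (2 * of_real pi * \<i> * of_nat (Suc n)) ^ j * a n)"
proof (induction j)
  case (Suc j)
  from disc_summable_cmult [OF disc_summable_Suc_mult [OF this], of "2 * of_real pi * \<i>"]
  show ?case by (simp add: mult_ac del: of_nat_Suc)
qed (use assms in simp)

lemma higher_deriv_qseries: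
  assumes a: "disc_summable a" and "\<tau> \<in> upper_half_plane"
  shows "(deriv ^^ j) (qseries a) \<tau> = qseries (\<lambda>n. (2 * of_real pi * \<i> * of_nat (Suc n)) ^ j * a n) \<tau>"
  using assms(2)
proof (induction j arbitrary: \<tau>)
  case (Suc j)
  have "((deriv ^^ j) (qseries a) has_field_derivative
      qseries (\<lambda>n. 2 * of_real pi * \<i> * of_nat (Suc n) * ((2 * of_real pi * \<i> * of_nat (Suc n)) ^ j * a n)) \<tau>) (at \<tau>)"
    by (rule has_field_derivative_transform_within_open
          [OF has_field_derivative_qseries [OF disc_summable_power [OF a] Suc.prems]
            open_upper_half_plane Suc.prems])
      (simp only: Suc.IH)
  from DERIV_imp_deriv [OF this] show ?case by (simp add: mult_ac)
qed simp

text \<open>Leibniz rule with a linear factor, so only two terms survive. For \<open>n = 0\<close>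
  the truncated \<open>n - 1\<close> is harmless, its coefficient being 0.\<close>

lemma higher_deriv_ident_mult:
  assumes f: "f holomorphic_on S" and S: "open S" and "z \<in> S"
  shows "(deriv ^^ n) (\<lambda>w. w * f w) z = z * (deriv ^^ n) f z + of_nat n * (deriv ^^ (n - 1)) f z"
  using assms(3)
proof (induction n arbitrary: z)
  case (Suc n)
  have d: "((deriv ^^ m) f has_field_derivative (deriv ^^ Suc m) f w) (at w)" if "w \<in> S" for m w
    using has_field_derivative_higher_deriv [OF f S that] by simp
  have "((\<lambda>w. w * (deriv ^^ n) f w + of_nat n * (deriv ^^ (n - 1)) f w) has_field_derivative
      (deriv ^^ n) f z + z * (deriv ^^ Suc n) f z + of_nat n * (deriv ^^ Suc (n - 1)) f z) (at z)"
    using Suc.prems by (auto intro!: derivative_eq_intros d)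
  then have "((deriv ^^ n) (\<lambda>w. w * f w) has_field_derivative
      (deriv ^^ n) f z + z * (deriv ^^ Suc n) f z + of_nat n * (deriv ^^ Suc (n - 1)) f z) (at z)"
    by (rule has_field_derivative_transform_within_open [OF _ S Suc.prems]) (simp add: Suc.IH)
  from DERIV_imp_deriv [OF this] show ?case
    by (cases n) (auto simp: algebra_simps)
qed simp

text \<open>Bol's identity for the inversion.\<close>

lemma higher_deriv_inversion:
  assumes f: "f holomorphic_on upper_half_plane" and "\<tau> \<in> upper_half_plane"
  shows "(deriv ^^ Suc n) (\<lambda>t. t ^ n * f (- 1 / t)) \<tau> =
         (deriv ^^ Suc n) f (- 1 / \<tau>) / \<tau> ^ (n + 2)"
  using assms(2)
proof (induction n arbitrary: \<tau>)
  case 0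
  have "\<tau> \<noteq> 0" using 0 by auto
  have "((\<lambda>t. f (- 1 / t)) has_field_derivative deriv f (- 1 / \<tau>) * (1 / \<tau> ^ 2)) (at \<tau>)"
    by (rule DERIV_chain2 [of f])
      (use \<open>\<tau> \<noteq> 0\<close> 0 in \<open>auto intro!: derivative_eq_intros simp: power2_eq_square
        holomorphic_derivI [OF f open_upper_half_plane minus_inverse_upper_half_plane, simplified]\<close>)
  from DERIV_imp_deriv [OF this] show ?case by (simp add: power2_eq_square)
next
  case (Suc n)
  define g where "g = (\<lambda>t. t ^ n * f (- 1 / t))"
  have \<tau>: "\<tau> \<noteq> 0" using Suc.prems by auto
  have "(\<lambda>t. f (- 1 / t)) holomorphic_on upper_half_plane"
    by (rule holomorphic_on_compose_gen [OF _ f, unfolded o_def])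
      (auto intro!: holomorphic_intros minus_inverse_upper_half_plane [simplified])
  then have g: "g holomorphic_on upper_half_plane"
    unfolding g_def by (intro holomorphic_intros)
  let ?F = "\<lambda>m. (deriv ^^ m) f"
  have "(?F (Suc n) has_field_derivative ?F (Suc (Suc n)) (- 1 / \<tau>)) (at (- 1 / \<tau>))"
    using has_field_derivative_higher_deriv
      [OF f open_upper_half_plane minus_inverse_upper_half_plane [OF Suc.prems], of "Suc n"] by simp
  moreover have "((\<lambda>t. - 1 / t) has_field_derivative 1 / \<tau> ^ 2) (at \<tau>)"
    using \<tau> by (auto intro!: derivative_eq_intros simp: power2_eq_square)
  ultimately have "((\<lambda>t. ?F (Suc n) (- 1 / t)) has_field_derivative
      ?F (Suc (Suc n)) (- 1 / \<tau>) * (1 / \<tau> ^ 2)) (at \<tau>)"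
    by (rule DERIV_chain2)
  then have "((\<lambda>t. ?F (Suc n) (- 1 / t) / t ^ (n + 2)) has_field_derivative
      (?F (Suc (Suc n)) (- 1 / \<tau>) * (1 / \<tau> ^ 2) * \<tau> ^ (n + 2)
        - ?F (Suc n) (- 1 / \<tau>) * (of_nat (n + 2) * \<tau> ^ (n + 1))) / (\<tau> ^ (n + 2) * \<tau> ^ (n + 2))) (at \<tau>)"
    by (rule DERIV_divide) (use \<tau> DERIV_power [OF DERIV_ident, of "n + 2" \<tau>] in auto)
  then have "((deriv ^^ Suc n) g has_field_derivative
      (?F (Suc (Suc n)) (- 1 / \<tau>) * (1 / \<tau> ^ 2) * \<tau> ^ (n + 2)
        - ?F (Suc n) (- 1 / \<tau>) * (of_nat (n + 2) * \<tau> ^ (n + 1))) / (\<tau> ^ (n + 2) * \<tau> ^ (n + 2))) (at \<tau>)"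
    by (rule has_field_derivative_transform_within_open [OF _ open_upper_half_plane Suc.prems])
      (simp only: Suc.IH g_def)
  from DERIV_imp_deriv [OF this]
  have *: "(deriv ^^ Suc (Suc n)) g \<tau> = (?F (Suc (Suc n)) (- 1 / \<tau>) * (1 / \<tau> ^ 2) * \<tau> ^ (n + 2)
        - ?F (Suc n) (- 1 / \<tau>) * (of_nat (n + 2) * \<tau> ^ (n + 1))) / (\<tau> ^ (n + 2) * \<tau> ^ (n + 2))"
    by simp
  \<comment> \<open>One more power of t is a linear factor, so only the two highest derivatives of
    \<open>g\<close> enter. The term with factor -(n + 2) in \<open>*\<close>, from differentiating
    the denominator, cancels the second Leibniz term.\<close>
  have "(\<lambda>t. t ^ Suc n * f (- 1 / t)) = (\<lambda>t. t * g t)"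
    by (simp add: g_def mult.assoc)
  then have "(deriv ^^ Suc (Suc n)) (\<lambda>t. t ^ Suc n * f (- 1 / t)) \<tau> =
      \<tau> * (deriv ^^ Suc (Suc n)) g \<tau> + of_nat (Suc (Suc n)) * (deriv ^^ Suc n) g \<tau>"
    using higher_deriv_ident_mult [OF g open_upper_half_plane Suc.prems, of "Suc (Suc n)"] by simp
  also have "(deriv ^^ Suc n) g \<tau> = ?F (Suc n) (- 1 / \<tau>) / \<tau> ^ (n + 2)"
    unfolding g_def by (rule Suc.IH [OF Suc.prems])
  also have "\<tau> * (deriv ^^ Suc (Suc n)) g \<tau> + of_nat (Suc (Suc n)) * (?F (Suc n) (- 1 / \<tau>) / \<tau> ^ (n + 2))
      = ?F (Suc (Suc n)) (- 1 / \<tau>) / \<tau> ^ (Suc n + 2)"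
    unfolding * using \<tau> by (simp del: funpow.simps of_nat_Suc add: field_simps power2_eq_square)
  finally show ?case .
qed

section \<open>Logarithms and polynomials through their higher derivatives\<close>

lemma higher_deriv_Ln:
  assumes "z \<in> upper_half_plane"
  shows "(deriv ^^ Suc n) Ln z = (- 1) ^ n * fact n / z ^ Suc n"
  using assms
proof (induction n arbitrary: z)
  case 0
  then have "z \<notin> \<real>\<^sub>\<le>\<^sub>0" by (auto simp: upper_half_plane_def complex_nonpos_Reals_iff)
  from DERIV_imp_deriv [OF has_field_derivative_Ln [OF this]] show ?case
    by (simp add: field_simps)
next
  case (Suc n)
  have "z \<noteq> 0" using Suc.prems by auto
  then have "((\<lambda>z. (- 1) ^ n * fact n / z ^ Suc n) has_field_derivative
      (0 * z ^ Suc n - (- 1) ^ n * fact n * (of_nat (Suc n) * z ^ n)) / (z ^ Suc n * z ^ Suc n)) (at z)"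
    by (intro DERIV_divide DERIV_const) (use DERIV_power [OF DERIV_ident, of "Suc n" z] in auto)
  also have "(0 * z ^ Suc n - (- 1) ^ n * fact n * (of_nat (Suc n) * z ^ n)) / (z ^ Suc n * z ^ Suc n)
      = (- 1) ^ Suc n * fact (Suc n) / z ^ Suc (Suc n)"
    using \<open>z \<noteq> 0\<close> by (simp add: field_simps)
  finally have "((\<lambda>z. (- 1) ^ n * fact n / z ^ Suc n) has_field_derivative
      (- 1) ^ Suc n * fact (Suc n) / z ^ Suc (Suc n)) (at z)" .
  then have "((deriv ^^ Suc n) Ln has_field_derivative
      (- 1) ^ Suc n * fact (Suc n) / z ^ Suc (Suc n)) (at z)"
    by (rule has_field_derivative_transform_within_open [OF _ open_upper_half_plane Suc.prems])
      (simp only: Suc.IH)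
  from DERIV_imp_deriv [OF this] show ?case by simp
qed

lemma holomorphic_Ln_upper_half_plane: "Ln holomorphic_on upper_half_plane"
  by (intro holomorphic_on_Ln) (auto simp: upper_half_plane_def complex_nonpos_Reals_iff)

text \<open>The two Leibniz terms have opposite signs and sizes n! and (n + 1) (n - 1)!, which
  differ by (n - 1)!.\<close>

lemma higher_deriv_mult_Ln:
  assumes "z \<in> upper_half_plane" and "n > 0"
  shows "(deriv ^^ Suc n) (\<lambda>z. z * Ln z) z = (- 1) ^ (n - 1) * fact (n - 1) / z ^ n"
proof -
  have "z \<noteq> 0" using assms by auto
  obtain m where n: "n = Suc m" using assms(2) by (cases n) auto
  show ?thesis
    using higher_deriv_ident_mult [OF holomorphic_Ln_upper_half_plane open_upper_half_plane assms(1), of "Suc n"]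
      higher_deriv_Ln [OF assms(1), of n] higher_deriv_Ln [OF assms(1), of m] \<open>z \<noteq> 0\<close>
    by (simp del: funpow.simps add: n field_simps)
qed

text \<open>The Taylor series at a point of \<open>S\<close> terminates, and the identity theorem
  carries the equality from a disc to all of the connected set.\<close>

lemma polynomial_if_higher_deriv_eq_0:
  assumes f: "f holomorphic_on S" and S: "open S" "connected S"
    and 0: "\<And>z. z \<in> S \<Longrightarrow> (deriv ^^ Suc n) f z = 0"
  obtains p where "degree p \<le> n" "\<And>z. z \<in> S \<Longrightarrow> f z = poly p z"
proof (cases "S = {}")
  case True
  with that [of 0] show ?thesis by auto
next
  case False
  then obtain a where a: "a \<in> S" by blast
  then obtain r where r: "r > 0" "ball a r \<subseteq> S" using S(1) openE by blast
  define p where "p = (\<Sum>i\<le>n. smult ((deriv ^^ i) f a / fact i) ([:- a, 1:] ^ i))"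
  have zero: "(deriv ^^ m) f z = 0" if "m > n" "z \<in> S" for m z
    using that
  proof (induction m arbitrary: z)
    case (Suc m)
    show ?case
    proof (cases "m = n")
      case True
      with 0 Suc show ?thesis by simp
    next
      case False
      then have *: "(deriv ^^ m) f w = 0" if "w \<in> S" for w using Suc that by auto
      have "((deriv ^^ m) f has_field_derivative 0) (at z)"
        by (rule has_field_derivative_transform_within_open [OF DERIV_const [of 0] S(1) Suc.prems(2)])
          (simp add: *)
      then show ?thesis by (simp add: DERIV_imp_deriv)
    qed
  qed simp
  have ball: "f w = poly p w" if w: "w \<in> ball a r" for w
  proof -
    have "(\<lambda>i. (deriv ^^ i) f a / fact i * (w - a) ^ i) sums f w"
      using holomorphic_power_series [OF holomorphic_on_subset [OF f r(2)] w] .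
    moreover have "(\<lambda>i. (deriv ^^ i) f a / fact i * (w - a) ^ i) sums
        (\<Sum>i\<in>{..n}. (deriv ^^ i) f a / fact i * (w - a) ^ i)"
      by (rule sums_finite) (use zero a in auto)
    ultimately have "f w = (\<Sum>i\<le>n. (deriv ^^ i) f a / fact i * (w - a) ^ i)"
      by (rule sums_unique2)
    then show ?thesis by (simp add: p_def poly_sum)
  qed
  have "f z = poly p z" if "z \<in> S" for z
    by (rule analytic_continuation_open [of "ball a r" S f "poly p"])
      (use r S f ball that in \<open>auto intro!: holomorphic_intros\<close>)
  moreover have "degree p \<le> n"
    unfolding p_def
  proof (rule degree_sum_le)
    fix i assume "i \<in> {..n}"
    have "degree (smult ((deriv ^^ i) f a / fact i) ([:- a, 1:] ^ i)) \<le> degree ([:- a, 1:] ^ i)"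
      by (rule degree_smult_le)
    also have "\<dots> \<le> degree [:- a, 1:] * i" by (rule degree_power_le)
    finally show "degree (smult ((deriv ^^ i) f a / fact i) ([:- a, 1:] ^ i)) \<le> n"
      using \<open>i \<in> {..n}\<close> by simp
  qed simp
  ultimately show ?thesis using that by blast
qed

section \<open>The Lipschitz formula and zeta at even integers\<close>

text \<open>Both sides come from differentiating Gamma(z) Gamma(1 - z) = pi / sin(pi z): once by the
  product rule, once on the right-hand side.\<close>

lemma Digamma_reflection:
  fixes z :: complex
  assumes z: "z \<notin> \<int>"
  shows "Digamma (1 - z) - Digamma z = of_real pi * cot (of_real pi * z)"
proof -
  have z1: "1 - z \<notin> \<int>"
  proof
    assume "1 - z \<in> \<int>"
    then have "1 - (1 - z) \<in> \<int>" by (intro Ints_diff) auto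
    with z show False by simp
  qed
  have nonpos: "z \<notin> \<int>\<^sub>\<le>\<^sub>0" "1 - z \<notin> \<int>\<^sub>\<le>\<^sub>0"
    using z z1 nonpos_Ints_Int by blast+
  let ?G = "Gamma z * Gamma (1 - z)"
  have s: "sin (of_real pi * z) \<noteq> 0"
  proof
    assume "sin (of_real pi * z) = 0"
    then obtain n :: int where "of_real pi * z = of_real (of_int n * pi)"
      by (auto simp: Complex_Transcendental.sin_eq_0)
    then have "of_real pi * z = of_real pi * of_int n" by simp
    then have "z = of_int n" by (subst (asm) mult_left_cancel) auto
    with z show False by auto
  qed
  have "((\<lambda>z. Gamma z * Gamma (1 - z)) has_field_derivative ?G * (Digamma z - Digamma (1 - z))) (at z)"
    using nonpos by (auto intro!: derivative_eq_intros simp: algebra_simps)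
  moreover have "((\<lambda>z. Gamma z * Gamma (1 - z)) has_field_derivative
      - (?G * (of_real pi * cot (of_real pi * z)))) (at z)"
    unfolding Gamma_reflection_complex
    using s by (auto intro!: derivative_eq_intros simp: cot_def field_simps)
  ultimately have "?G * (Digamma z - Digamma (1 - z)) = - (?G * (of_real pi * cot (of_real pi * z)))"
    by (rule DERIV_unique)
  moreover have "?G \<noteq> 0"
    using nonpos by (simp add: Gamma_eq_zero_iff)
  ultimately have "Digamma z - Digamma (1 - z) = - (of_real pi * cot (of_real pi * z))"
    by (metis mult_left_cancel mult_minus_right)
  then show ?thesis by (simp add: algebra_simps)
qed

text \<open>Euler's formulas. This form is used twice: as a geometric series it gives a q-series,
  and times z it gives the Bernoulli generating function at 2 pi i z.\<close>

lemma pi_cot_eq_exp: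
  fixes z :: complex
  assumes "z \<notin> \<int>"
  shows "exp (2 * of_real pi * \<i> * z) \<noteq> 1"
    and "of_real pi * cot (of_real pi * z) =
           of_real pi * \<i> + 2 * of_real pi * \<i> / (exp (2 * of_real pi * \<i> * z) - 1)"
proof -
  define e where "e = exp (\<i> * (of_real pi * z))"
  have e: "exp (2 * of_real pi * \<i> * z) = e ^ 2"
    unfolding e_def by (simp flip: exp_of_nat_mult add: mult_ac)
  have e0: "e \<noteq> 0" by (simp add: e_def)
  show *: "exp (2 * of_real pi * \<i> * z) \<noteq> 1"
  proof
    assume "exp (2 * of_real pi * \<i> * z) = 1"
    then obtain n :: int where n: "Re (2 * of_real pi * \<i> * z) = 0" "Im (2 * of_real pi * \<i> * z) = of_int (2 * n) * pi"
      by (auto simp: exp_eq_1)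
    then have "z = of_int n" by (simp add: complex_eq_iff)
    with assms show False by auto
  qed
  have s: "sin (of_real pi * z) = (e - inverse e) / (2 * \<i>)"
    and c: "cos (of_real pi * z) = (e + inverse e) / 2"
    by (simp_all add: sin_exp_eq cos_exp_eq e_def exp_minus)
  have "cot (of_real pi * z) = \<i> * (e ^ 2 + 1) / (e ^ 2 - 1)"
    unfolding cot_def s c using e0 * e by (simp add: field_simps power2_eq_square)
  also have "of_real pi * \<dots> = of_real pi * \<i> + 2 * of_real pi * \<i> / (e ^ 2 - 1)"
    using * e by (simp add: field_simps)
  finally show "of_real pi * cot (of_real pi * z) =
      of_real pi * \<i> + 2 * of_real pi * \<i> / (exp (2 * of_real pi * \<i> * z) - 1)"
    by (simp add: e)
qed

lemma upper_half_plane_not_Ints: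
  assumes "z \<in> upper_half_plane"
  shows "z \<notin> \<int>" "1 - z \<notin> \<int>\<^sub>\<le>\<^sub>0" "z \<notin> \<int>\<^sub>\<le>\<^sub>0"
  using assms by (auto simp: upper_half_plane_def elim!: Ints_cases nonpos_Ints_cases dest!: arg_cong [of _ _ Im])

lemma disc_summable_1: "disc_summable (\<lambda>_. 1)"
  by (rule disc_summable_bounded) simp

lemma disc_summable_of_nat_power: "disc_summable (\<lambda>n. of_nat (Suc n) ^ j)"
  by (induction j) (use disc_summable_1 disc_summable_Suc_mult in auto)

text \<open>The geometric series gives 1 / (q - 1) = -1 - q / (1 - q); the -1 turns pi i into - pi
  i.\<close>

lemma pi_cot_eq_qseries:
  assumes z: "z \<in> upper_half_plane"
  shows "of_real pi * cot (of_real pi * z) = - (of_real pi * \<i>) - 2 * of_real pi * \<i> * qseries (\<lambda>_. 1) z"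
proof -
  define q where "q = exp (2 * of_real pi * \<i> * z)"
  have q: "norm q < 1" using exp_upper_half_plane [OF z] by (simp add: q_def)
  then have "q \<noteq> 1" by auto
  have "qseries (\<lambda>_. 1) z = (\<Sum>n. q * q ^ n)"
    unfolding qseries_def exp_of_nat_Suc q_def by simp
  also have "\<dots> = q / (1 - q)"
    using q by (subst suminf_mult) (auto simp: suminf_geometric)
  finally have qs: "qseries (\<lambda>_. 1) z = q / (1 - q)" .
  show ?thesis
    unfolding qs pi_cot_eq_exp(2) [OF upper_half_plane_not_Ints(1) [OF z]] q_def [symmetric]
    using \<open>q \<noteq> 1\<close> by (simp add: divide_simps) (simp add: algebra_simps)
qed

text \<open>This is the j-th derivative of the reflection formula: Polygamma at z and at 1 - z
  supply the two halves of a sum over all integers, and the cotangent supplies the q-series. For odd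
  \<open>j\<close> all signs agree.\<close>

lemma Lipschitz_formula:
  assumes z: "z \<in> upper_half_plane" and j: "odd j"
  shows "(\<Sum>n. inverse ((z + of_nat n) ^ Suc j)) + (\<Sum>n. inverse ((z - of_nat (Suc n)) ^ Suc j)) =
         (2 * of_real pi * \<i>) ^ Suc j / fact j * qseries (\<lambda>n. of_nat (Suc n) ^ j) z"
proof -
  have j0: "j > 0" using j by (auto intro: Nat.gr0I)
  have nz: "z \<noteq> 0" "1 - z \<noteq> 0" using upper_half_plane_not_Ints [OF z] by auto
  have P1: "Polygamma j z = fact j * (\<Sum>n. inverse ((z + of_nat n) ^ Suc j))"
    unfolding sums_unique [OF Polygamma_LIMSEQ [OF nz(1) j0], symmetric] using j by simp
  have "Polygamma j (1 - z) = fact j * (\<Sum>n. inverse ((1 - z + of_nat n) ^ Suc j))"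
    unfolding sums_unique [OF Polygamma_LIMSEQ [OF nz(2) j0], symmetric] using j by simp
  also have "(\<lambda>n. (1 - z + of_nat n) ^ Suc j) = (\<lambda>n. (z - of_nat (Suc n)) ^ Suc j)"
  proof
    fix n
    have "1 - z + of_nat n = - (z - of_nat (Suc n))" by simp
    then show "(1 - z + of_nat n) ^ Suc j = (z - of_nat (Suc n)) ^ Suc j"
      using j by (simp only: uminus_power_if even_Suc not_not if_True not_False_eq_True)
  qed
  finally have P2: "Polygamma j (1 - z) = fact j * (\<Sum>n. inverse ((z - of_nat (Suc n)) ^ Suc j))" .
  have T: "open (- \<int>\<^sub>\<le>\<^sub>0 :: complex set)" by (simp add: open_Compl)
  \<comment> \<open>The argument is put into the shape u w + c expected by the rule for linear
    substitutions.\<close>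
  have "(deriv ^^ j) (\<lambda>w. Digamma (1 - w)) z = (deriv ^^ j) (\<lambda>w. Digamma (- 1 * w + 1)) z"
    by simp
  also have "\<dots> = (- 1) ^ j * (deriv ^^ j) Digamma (- 1 * z + 1)"
    by (rule higher_deriv_compose_linear' [OF _ open_upper_half_plane T z])
      (auto intro!: holomorphic_intros dest: upper_half_plane_not_Ints)
  also have "(deriv ^^ j) Digamma (- 1 * z + 1) = Polygamma j (1 - z)"
    using higher_deriv_Polygamma [of "1 - z" j 0] upper_half_plane_not_Ints [OF z] by simp
  finally have D1: "(deriv ^^ j) (\<lambda>w. Digamma (1 - w)) z = - Polygamma j (1 - z)"
    using j by simp
  have D2: "(deriv ^^ j) Digamma z = Polygamma j z"
    using higher_deriv_Polygamma [of z j 0] upper_half_plane_not_Ints [OF z] by simp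
  have h: "(\<lambda>w. Digamma (1 - w)) holomorphic_on upper_half_plane"
    by (rule holomorphic_on_compose_gen [OF _ holomorphic_on_Polygamma, unfolded o_def, where t = "- \<int>\<^sub>\<le>\<^sub>0"])
      (auto intro!: holomorphic_intros dest: upper_half_plane_not_Ints)
  have h': "Digamma holomorphic_on upper_half_plane"
    by (rule holomorphic_on_Polygamma) (auto dest: upper_half_plane_not_Ints)
  note q = holomorphic_qseries [OF disc_summable_1]
  have "- Polygamma j (1 - z) - Polygamma j z = (deriv ^^ j) (\<lambda>w. Digamma (1 - w) - Digamma w) z"
    using higher_deriv_diff [OF h h' open_upper_half_plane z, of j] by (simp add: D1 D2)
  also have "\<dots> = (deriv ^^ j) (\<lambda>w. - (of_real pi * \<i>) - 2 * of_real pi * \<i> * qseries (\<lambda>_. 1) w) z"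
    by (rule higher_deriv_transform_within_open [OF _ _ open_upper_half_plane z])
      (use h h' q in \<open>auto intro!: holomorphic_intros
        simp: Digamma_reflection pi_cot_eq_qseries upper_half_plane_not_Ints(1)\<close>)
  also have "\<dots> = (deriv ^^ j) (\<lambda>w. - (of_real pi * \<i>)) z - (deriv ^^ j) (\<lambda>w. 2 * of_real pi * \<i> * qseries (\<lambda>_. 1) w) z"
    by (rule higher_deriv_diff [OF _ _ open_upper_half_plane z]) (use q in \<open>auto intro!: holomorphic_intros\<close>)
  also have "\<dots> = - (2 * of_real pi * \<i> * (deriv ^^ j) (qseries (\<lambda>_. 1)) z)"
    using j0 higher_deriv_cmult [OF q z open_upper_half_plane, of j "2 * of_real pi * \<i>"] by simp
  also have "(deriv ^^ j) (qseries (\<lambda>_. 1)) z = qseries (\<lambda>n. (2 * of_real pi * \<i>) ^ j * of_nat (Suc n) ^ j) z"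
    using higher_deriv_qseries [OF disc_summable_1 z, of j] by (simp only: power_mult_distrib mult_1_right)
  also have "\<dots> = (2 * of_real pi * \<i>) ^ j * qseries (\<lambda>n. of_nat (Suc n) ^ j) z"
    unfolding qseries_def
    by (subst suminf_mult [OF summable_qseries [OF disc_summable_of_nat_power z], symmetric])
      (simp only: mult.assoc)
  finally show ?thesis
    unfolding P1 P2 by (simp add: field_simps)
qed

text \<open>Replacing X by c X in the defining identity multiplies the n-th coefficient by c^n. The
  real series \<open>b\<close> is carried to the complex one \<open>B\<close>
  coefficientwise.\<close>

lemma exp_bernoulli_fps:
  fixes c :: complex
  assumes "c \<noteq> 0"
  shows "fps_nth (fps_const c * fps_X / (fps_exp c - 1)) n = c ^ n * of_real (bernoulli n) / fact n"
proof -
  define b :: "real fps" where "b = fps_X / (fps_exp 1 - 1)"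
  define B where "B = Abs_fps (\<lambda>n. c ^ n * of_real (fps_nth b n))"
  have sd: "subdegree (fps_exp 1 - 1 :: real fps) = 1"
    by (rule subdegreeI) auto
  have nz: "fps_exp 1 - 1 \<noteq> (0 :: real fps)"
    using sd by auto
  \<comment> \<open>The divisor has no constant term and is not a unit, so the quotient is exact
    only because the subdegrees match.\<close>
  have "(fps_exp 1 - 1 :: real fps) dvd fps_X"
    using nz sd by (simp add: fps_dvd_iff)
  then have b: "b * (fps_exp 1 - 1) = fps_X" by (simp add: b_def)
  have "B * (fps_exp c - 1) = fps_const c * fps_X"
  proof (rule fps_ext)
    fix n
    have "fps_nth (B * (fps_exp c - 1)) n = (\<Sum>i=0..n. c ^ n * of_real (fps_nth b i * fps_nth (fps_exp 1 - 1) (n - i)))"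
      unfolding fps_mult_nth
    proof (rule sum.cong)
      fix i assume i: "i \<in> {0..n}"
      then have "c ^ n = c ^ i * c ^ (n - i)" by (simp flip: power_add)
      then show "fps_nth B i * fps_nth (fps_exp c - 1) (n - i) =
          c ^ n * of_real (fps_nth b i * fps_nth (fps_exp 1 - 1) (n - i))"
        by (auto simp: B_def)
    qed simp
    also have "\<dots> = c ^ n * of_real (fps_nth (b * (fps_exp 1 - 1)) n)"
      by (simp only: fps_mult_nth sum_distrib_left of_real_sum)
    also have "\<dots> = fps_nth (fps_const c * fps_X) n"
      by (cases "n = 1") (auto simp: b fps_X_def)
    finally show "fps_nth (B * (fps_exp c - 1)) n = fps_nth (fps_const c * fps_X) n" .
  qed
  moreover have "fps_exp c - 1 \<noteq> 0"
  proof
    assume "fps_exp c - 1 = 0"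
    then have "fps_nth (fps_exp c - 1) 1 = 0" by (simp only: fps_zero_nth)
    with assms show False by simp
  qed
  ultimately have "fps_const c * fps_X / (fps_exp c - 1) = B"
    by (metis nonzero_mult_div_cancel_right)
  then show ?thesis
    by (simp add: B_def b_def bernoulli_def)
qed

text \<open>Compare two expansions of z F(z) at 0: derivatives of Digamma at 1 are zeta values, and
  the cotangent gives the Bernoulli generating function.\<close>

lemma zeta_even_bernoulli:
  assumes j: "odd j"
  shows "(\<Sum>n. inverse (of_nat (Suc n) ^ Suc j)) =
         - ((2 * of_real pi * \<i>) ^ Suc j * of_real (bernoulli (Suc j)) / (2 * fact (Suc j)))"
proof -
  define c where "c = 2 * of_real pi * \<i>"
  have c: "c \<noteq> 0" by (simp add: c_def)
  have j0: "j > 0" using j by (auto intro: Nat.gr0I)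
  \<comment> \<open>Taking 1 + z instead of z removes the pole at 0, since Digamma(1 + z) =
    Digamma(z) + 1/z. This accounts for the -1 in \<open>exp_eq\<close>.\<close>
  define F :: "complex \<Rightarrow> complex" where "F = (\<lambda>z. Digamma (1 - z) - Digamma (1 + z))"
  define S :: "complex set" where "S = ball 0 1"
  have S: "open S" "0 \<in> S" by (auto simp: S_def)
  have nonpos: "1 - z \<notin> \<int>\<^sub>\<le>\<^sub>0" "1 + z \<notin> \<int>\<^sub>\<le>\<^sub>0" if "z \<in> S" for z
  proof -
    have "\<bar>Re z\<bar> < 1" using that abs_Re_le_cmod [of z] by (simp add: S_def)
    then have "Re (1 - z) > 0" "Re (1 + z) > 0" by auto
    then show "1 - z \<notin> \<int>\<^sub>\<le>\<^sub>0" "1 + z \<notin> \<int>\<^sub>\<le>\<^sub>0"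
      by (metis nonpos_Ints_cases Re_complex_of_real of_int_le_0_iff of_real_of_int_eq not_le)+
  qed
  have T: "open (- \<int>\<^sub>\<le>\<^sub>0 :: complex set)" by (simp add: open_Compl)
  have h1: "(\<lambda>w. Digamma (1 - w)) holomorphic_on S" and h2: "(\<lambda>w. Digamma (1 + w)) holomorphic_on S"
    by (rule holomorphic_on_compose_gen [OF _ holomorphic_on_Polygamma, unfolded o_def, where t = "- \<int>\<^sub>\<le>\<^sub>0"],
       auto intro!: holomorphic_intros dest: nonpos)+
  have F: "F holomorphic_on S"
    unfolding F_def using h1 h2 by (intro holomorphic_intros)
  have exp_eq: "z * F z = (if z = 0 then 1 else c * z / (exp (c * z) - 1)) - 1 + of_real pi * \<i> * z" if "z \<in> S" for z
  proof (cases "z = 0")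
    case False
    have "z \<notin> \<int>"
    proof
      assume "z \<in> \<int>"
      then obtain n where n: "z = of_int n" by (auto elim: Ints_cases)
      with that have "\<bar>n\<bar> < 1" by (simp add: S_def)
      with n False show False by simp
    qed
    note * = pi_cot_eq_exp [OF this, folded c_def] Digamma_reflection [OF this]
    have "Digamma (1 + z) = Digamma z + 1 / z"
      using Digamma_plus1 [OF False] by (simp add: add.commute)
    then have "z * F z = z * (of_real pi * cot (of_real pi * z)) - 1"
      using False by (simp add: F_def flip: *(3)) (simp add: field_simps)
    then show ?thesis
      using False by (simp add: *(2)) (simp add: field_simps c_def)
  qed simp
  have "(\<lambda>z. (if z = 0 then 1 else c * z / (exp (c * z) - 1)) - 1 + of_real pi * \<i> * z) has_fps_expansion
      fps_const c * fps_X / (fps_exp c - 1) - 1 + fps_const (of_real pi * \<i>) * fps_X"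
  proof (intro fps_expansion_intros)
    have sd: "subdegree (fps_exp c - 1) = 1" "subdegree (fps_const c * fps_X) = 1"
      using c by (auto intro!: subdegreeI)
    then show "subdegree (fps_exp c - 1) \<le> subdegree (fps_const c * fps_X)"
      and "fps_exp c - 1 \<noteq> 0"
      and "1 = fps_nth (fps_const c * fps_X) (subdegree (fps_exp c - 1)) / fps_nth (fps_exp c - 1) (subdegree (fps_exp c - 1))"
      using c by auto
  qed
  note expansion = this
  have "eventually (\<lambda>z. z \<in> S) (nhds 0)"
    using S by (rule eventually_nhds_in_open)
  then have "eventually (\<lambda>z. (if z = 0 then 1 else c * z / (exp (c * z) - 1)) - 1 + of_real pi * \<i> * z = z * F z) (nhds 0)"
    by eventually_elim (rule exp_eq [symmetric])
  from this expansion have "(\<lambda>z. z * F z) has_fps_expansion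
      fps_const c * fps_X / (fps_exp c - 1) - 1 + fps_const (of_real pi * \<i>) * fps_X"
    by (simp only: has_fps_expansion_cong [OF _ refl])
  \<comment> \<open>As \<open>Suc j\<close> is at least 2, the constant and the linear correction do
    not reach this coefficient.\<close>
  from fps_nth_fps_expansion [OF this, of "Suc j"]
  have "(deriv ^^ Suc j) (\<lambda>z. z * F z) 0 / fact (Suc j) = c ^ Suc j * of_real (bernoulli (Suc j)) / fact (Suc j)"
    using j0 by (simp add: exp_bernoulli_fps [OF c] del: funpow.simps fact_Suc power_Suc)
  moreover have "(deriv ^^ Suc j) (\<lambda>z. z * F z) 0 = of_nat (Suc j) * (deriv ^^ j) F 0"
    using higher_deriv_ident_mult [OF F S, of "Suc j"] by simp
  moreover have "(deriv ^^ j) F 0 = (deriv ^^ j) (\<lambda>w. Digamma (1 - w)) 0 - (deriv ^^ j) (\<lambda>w. Digamma (1 + w)) 0"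
    unfolding F_def by (rule higher_deriv_diff [OF h1 h2 S])
  moreover have "(deriv ^^ j) (\<lambda>w. Digamma (- 1 * w + 1)) 0 = (- 1) ^ j * (deriv ^^ j) Digamma (- 1 * 0 + 1 :: complex)"
    by (rule higher_deriv_compose_linear' [OF _ S(1) T S(2)])
      (auto intro!: holomorphic_intros dest: nonpos)
  moreover have "(deriv ^^ j) (\<lambda>w. Digamma (1 * w + 1)) 0 = 1 ^ j * (deriv ^^ j) Digamma (1 * 0 + 1 :: complex)"
    by (rule higher_deriv_compose_linear' [OF _ S(1) T S(2)])
      (auto intro!: holomorphic_intros dest: nonpos simp: add.commute)
  moreover have "(deriv ^^ j) Digamma (1 :: complex) = Polygamma j 1"
    using higher_deriv_Polygamma [of "1 :: complex" j 0] by simp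
  moreover have "Polygamma j (1 :: complex) = fact j * (\<Sum>n. inverse (of_nat (Suc n) ^ Suc j))"
    unfolding of_nat_Suc sums_unique [OF Polygamma_LIMSEQ [OF one_neq_zero j0], symmetric] using j by simp
  ultimately have "of_nat (Suc j) * (- (2 * (fact j * (\<Sum>n. inverse (of_nat (Suc n) ^ Suc j))))) / fact (Suc j) =
      c ^ Suc j * of_real (bernoulli (Suc j)) / fact (Suc j)"
    using j by (simp add: add.commute del: funpow.simps fact_Suc power_Suc of_nat_Suc)
  then have "of_nat (Suc j) * (- (2 * (fact j * (\<Sum>n. inverse (of_nat (Suc n) ^ Suc j))))) =
      c ^ Suc j * of_real (bernoulli (Suc j))"
    by (simp only: divide_cancel_right fact_nonzero simp_thms)
  from this [symmetric] show ?thesis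
    unfolding c_def [symmetric] by (simp add: field_simps del: of_nat_Suc power_Suc)
qed

section \<open>Eisenstein series\<close>

lemma has_sum_int_split:
  fixes f :: "int \<Rightarrow> 'a :: topological_comm_monoid_add"
  assumes "((\<lambda>n. f (int n)) has_sum a) UNIV" and "((\<lambda>n. f (- int (Suc n))) has_sum b) UNIV"
  shows "(f has_sum (a + b)) UNIV"
proof -
  have "(f has_sum a) (range int)"
    using assms(1) by (subst has_sum_reindex) (auto simp: o_def)
  moreover have "(f has_sum b) (range (\<lambda>n. - int (Suc n)))"
    using assms(2) by (subst has_sum_reindex) (auto simp: o_def inj_on_def)
  moreover have "range int \<inter> range (\<lambda>n. - int (Suc n)) = {}" by auto
  ultimately have "(f has_sum (a + b)) (range int \<union> range (\<lambda>n. - int (Suc n)))"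
    by (rule has_sum_Un_disjoint)
  also have "range int \<union> range (\<lambda>n. - int (Suc n)) = UNIV"
  proof -
    have "i \<in> range int \<union> range (\<lambda>n. - int (Suc n))" for i
      by (cases i rule: int_cases) auto
    then show ?thesis by auto
  qed
  finally show ?thesis .
qed

lemma infsum_int_split:
  fixes f :: "int \<Rightarrow> 'a :: banach"
  assumes "f summable_on UNIV"
  shows "summable (\<lambda>n. f (int n))" "summable (\<lambda>n. f (- int (Suc n)))"
    and "infsum f UNIV = (\<Sum>n. f (int n)) + (\<Sum>n. f (- int (Suc n)))"
proof -
  have "f summable_on range int" "f summable_on range (\<lambda>n. - int (Suc n))"
    using summable_on_subset_banach [OF assms] by auto
  then have *: "(\<lambda>n. f (int n)) summable_on UNIV" "(\<lambda>n. f (- int (Suc n))) summable_on UNIV"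
    by (subst (asm) summable_on_reindex; auto simp: o_def inj_on_def)+
  from * show "summable (\<lambda>n. f (int n))" "summable (\<lambda>n. f (- int (Suc n)))"
    by (auto intro: summable_on_imp_summable)
  show "infsum f UNIV = (\<Sum>n. f (int n)) + (\<Sum>n. f (- int (Suc n)))"
    using has_sum_int_split [OF has_sum_infsum [OF *(1)] has_sum_infsum [OF *(2)]]
      sums_unique [OF has_sum_imp_sums [OF has_sum_infsum [OF *(1)]]]
      sums_unique [OF has_sum_imp_sums [OF has_sum_infsum [OF *(2)]]]
    by (simp add: infsumI)
qed

text \<open>One-dimensional majorant: products of two such terms will dominate the lattice
  sum.\<close>

lemma summable_on_inverse_square_int:
  "(\<lambda>m::int. inverse ((1 + \<bar>of_int m\<bar>)\<^sup>2) :: real) summable_on UNIV"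
proof -
  have s: "summable (\<lambda>n. inverse ((of_nat (Suc n))\<^sup>2) :: real)"
    using inverse_squares_sums by (auto simp: summable_def inverse_eq_divide)
  then have "(\<lambda>n. inverse ((of_nat (Suc n))\<^sup>2) :: real) summable_on UNIV"
    by (subst summable_on_UNIV_nonneg_real_iff) auto
  \<comment> \<open>The negative integer \<open>- int (Suc n)\<close> gives 1 + (n + 1), hence the
    doubly shifted series.\<close>
  moreover have "(\<lambda>n. inverse ((of_nat (Suc (Suc n)))\<^sup>2) :: real) summable_on UNIV"
    using s [THEN summable_Suc_iff [THEN iffD2]]
    by (subst summable_on_UNIV_nonneg_real_iff) auto
  ultimately show ?thesis
    using has_sum_int_split [of "\<lambda>m. inverse ((1 + \<bar>of_int m\<bar>)\<^sup>2) :: real"]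
    by (force simp: summable_on_def add.commute)
qed

text \<open>The imaginary part m Im \<tau> controls m; then n is the lattice point minus m \<tau>.
  The constant adds up what the two estimates require.\<close>

lemma lattice_norm_bound:
  assumes "\<tau> \<in> upper_half_plane"
  obtains M where "M > 0"
    "\<And>m n :: int. \<bar>of_int m\<bar> \<le> M * norm (of_int m * \<tau> + of_int n)"
    "\<And>m n :: int. \<bar>of_int n\<bar> \<le> M * norm (of_int m * \<tau> + of_int n)"
proof
  have y: "Im \<tau> > 0" using assms by (simp add: upper_half_plane_def)
  define M where "M = 1 + (1 + norm \<tau>) / Im \<tau>"
  show "1 + (1 + norm \<tau>) / Im \<tau> > 0" using y by (intro add_pos_pos divide_pos_pos) (auto intro: add_pos_nonneg)
  fix m n :: int
  let ?N = "norm (of_int m * \<tau> + of_int n)"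
  have "\<bar>of_int m\<bar> * Im \<tau> = \<bar>Im (of_int m * \<tau> + of_int n)\<bar>"
    using y by (simp add: abs_mult)
  also have "\<dots> \<le> ?N" by (rule abs_Im_le_cmod)
  finally have m: "\<bar>of_int m\<bar> \<le> ?N / Im \<tau>"
    using y by (simp add: field_simps)
  also have "?N / Im \<tau> \<le> (1 + (1 + norm \<tau>) / Im \<tau>) * ?N"
    using y by (simp add: field_simps)
  finally show "\<bar>of_int m\<bar> \<le> (1 + (1 + norm \<tau>) / Im \<tau>) * ?N" .
  have "\<bar>of_int n\<bar> = norm ((of_int m * \<tau> + of_int n) - of_int m * \<tau>)"
    by simp
  also have "\<dots> \<le> ?N + norm (of_int m * \<tau>)" by (rule norm_triangle_ineq4)
  also have "norm (of_int m * \<tau>) \<le> ?N / Im \<tau> * norm \<tau>"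
    using mult_right_mono [OF m norm_ge_zero] by (simp add: norm_mult)
  also have "?N + ?N / Im \<tau> * norm \<tau> \<le> (1 + (1 + norm \<tau>) / Im \<tau>) * ?N"
    using y by (simp add: field_simps)
  finally show "\<bar>of_int n\<bar> \<le> (1 + (1 + norm \<tau>) / Im \<tau>) * ?N" by simp
qed

text \<open>The term at the origin of the lattice is \<open>inverse 0 = 0\<close>.\<close>

definition eisenstein :: "nat \<Rightarrow> complex \<Rightarrow> complex" where
  "eisenstein k \<tau> = (\<Sum>\<^sub>\<infinity>(m, n). inverse ((of_int m * \<tau> + of_int n) ^ k))"

text \<open>Four of the k factors 1/|m \<tau> + n| are spent as two squares, one decaying in m and
  one in n, so the majorant is a product. The other k - 4 are bounded by a constant.\<close>

lemma eisenstein_summable: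
  assumes \<tau>: "\<tau> \<in> upper_half_plane" and k: "k \<ge> 4"
  shows "(\<lambda>(m :: int, n :: int). inverse ((of_int m * \<tau> + of_int n) ^ k)) summable_on UNIV"
proof -
  obtain M where M: "M > 0"
    "\<And>m n :: int. \<bar>of_int m\<bar> \<le> M * norm (of_int m * \<tau> + of_int n)"
    "\<And>m n :: int. \<bar>of_int n\<bar> \<le> M * norm (of_int m * \<tau> + of_int n)"
    using lattice_norm_bound [OF \<tau>] by blast
  define h where "h = (\<lambda>m::int. inverse ((1 + \<bar>of_int m\<bar>)\<^sup>2) :: real)"
  \<comment> \<open>With x = 1/|m \<tau> + n|, both x and |i| x are at most \<open>M\<close> for i =
    m and i = n, so x (1 + |i|) is at most 2 M.\<close>
  define L where "L = 2 * M"
  have bound: "norm (inverse ((of_int m * \<tau> + of_int n) ^ k)) \<le> L ^ k * (h m * h n)" for m n :: int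
  proof (cases "of_int m * \<tau> + of_int n = 0")
    case True
    then show ?thesis using k M by (auto simp: L_def h_def zero_power)
  next
    case False
    define x where "x = inverse (norm (of_int m * \<tau> + of_int n))"
    have x: "x > 0" "norm (of_int m * \<tau> + of_int n) * x = 1" using False by (auto simp: x_def)
    have m: "\<bar>of_int m\<bar> * x \<le> M" and n: "\<bar>of_int n\<bar> * x \<le> M"
      using mult_right_mono [OF M(2) [of m n], of x] mult_right_mono [OF M(3) [of n m], of x] x
      by (auto simp: mult.assoc)
    have "m \<noteq> 0 \<or> n \<noteq> 0" using False by auto
    then have "1 \<le> \<bar>real_of_int m\<bar> \<or> 1 \<le> \<bar>real_of_int n\<bar>" by linarith
    then have x1: "x \<le> M"
    proof
      assume "1 \<le> \<bar>real_of_int m\<bar>"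
      then have "1 * x \<le> \<bar>real_of_int m\<bar> * x" using x by (intro mult_right_mono) auto
      with m show ?thesis by simp
    next
      assume "1 \<le> \<bar>real_of_int n\<bar>"
      then have "1 * x \<le> \<bar>real_of_int n\<bar> * x" using x by (intro mult_right_mono) auto
      with n show ?thesis by simp
    qed
    have *: "x\<^sup>2 \<le> L\<^sup>2 * h i" if "\<bar>of_int i\<bar> * x \<le> M" for i
    proof -
      have "x * (1 + \<bar>of_int i\<bar>) \<le> L" using that x1 by (simp add: L_def algebra_simps)
      then have "(x * (1 + \<bar>of_int i\<bar>))\<^sup>2 \<le> L\<^sup>2" using x by (intro power_mono) auto
      then have "x\<^sup>2 * (1 + \<bar>of_int i\<bar>)\<^sup>2 \<le> L\<^sup>2" by (simp only: power_mult_distrib)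
      moreover have "(1 + \<bar>real_of_int i\<bar>)\<^sup>2 > 0" by (intro zero_less_power add_pos_nonneg) auto
      ultimately show ?thesis
        unfolding h_def by (simp only: pos_le_divide_eq flip: divide_inverse)
    qed
    have "norm (inverse ((of_int m * \<tau> + of_int n) ^ k)) = x ^ k"
      by (simp add: x_def norm_inverse norm_power power_inverse)
    also have "\<dots> = x ^ (k - 4) * (x\<^sup>2 * x\<^sup>2)"
      using k by (simp flip: power_add)
    also have "\<dots> \<le> L ^ (k - 4) * ((L\<^sup>2 * h m) * (L\<^sup>2 * h n))"
      by (intro mult_mono power_mono * m n)
        (use x x1 M in \<open>auto simp: h_def L_def intro!: mult_nonneg_nonneg\<close>)
    also have "\<dots> = L ^ (k - 4 + 2 + 2) * (h m * h n)"
      unfolding power_add by (simp add: mult_ac)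
    also have "k - 4 + 2 + 2 = k" using k by simp
    finally show ?thesis .
  qed
  have hs: "h summable_on UNIV"
    unfolding h_def by (rule summable_on_inverse_square_int)
  then obtain H where H: "(h has_sum H) UNIV" by (auto simp: summable_on_def)
  have "(\<lambda>(m, n). L ^ k * (h m * h n)) summable_on (SIGMA m:UNIV. UNIV)"
  proof (rule summable_on_SigmaI)
    show "((\<lambda>n. case (m, n) of (m, n) \<Rightarrow> L ^ k * (h m * h n)) has_sum L ^ k * (h m * H)) UNIV" for m
      using H by (auto intro!: has_sum_cmult_right)
    show "(\<lambda>m. L ^ k * (h m * H)) summable_on UNIV"
      using hs by (intro summable_on_cmult_right summable_on_cmult_left)
  qed (use M in \<open>auto simp: h_def L_def\<close>)
  then have "(\<lambda>(m, n). L ^ k * (h m * h n)) summable_on UNIV" by simp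
  then have "(\<lambda>p. norm (case p of (m :: int, n :: int) \<Rightarrow> inverse ((of_int m * \<tau> + of_int n) ^ k))) summable_on UNIV"
    by (rule summable_on_comparison_test) (use bound in auto)
  then show ?thesis by (rule abs_summable_summable)
qed

text \<open>m (-1/\<tau>) + n = (n \<tau> - m) / \<tau>, and (m, n) to (n, -m) permutes the lattice.
  Summing unordered over pairs avoids exchanging iterated sums.\<close>

lemma eisenstein_inversion:
  assumes "\<tau> \<noteq> 0"
  shows "eisenstein k (- 1 / \<tau>) = \<tau> ^ k * eisenstein k \<tau>"
proof -
  have bij: "bij (\<lambda>(m :: int, n :: int). (n, - m))"
    by (rule bij_betw_byWitness [where f' = "\<lambda>(m, n). (- n, m)"]) auto
  have "inverse ((of_int m * (- 1 / \<tau>) + of_int n) ^ k) =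
      \<tau> ^ k * inverse ((of_int n * \<tau> + of_int (- m)) ^ k)" for m n :: int
  proof -
    have "of_int m * (- 1 / \<tau>) + of_int n = (of_int n * \<tau> + of_int (- m)) / \<tau>"
      using assms by (simp add: field_simps)
    then show ?thesis by (simp only: power_divide inverse_divide) (simp add: divide_inverse)
  qed
  then have "eisenstein k (- 1 / \<tau>) =
      (\<Sum>\<^sub>\<infinity>p. \<tau> ^ k * (case (case p of (m, n) \<Rightarrow> (n, - m)) of (m, n) \<Rightarrow> inverse ((of_int m * \<tau> + of_int n) ^ k)))"
    unfolding eisenstein_def by (intro infsum_cong) auto
  also have "\<dots> = (\<Sum>\<^sub>\<infinity>p. \<tau> ^ k * (case p of (m, n) \<Rightarrow> inverse ((of_int m * \<tau> + of_int n) ^ k)))"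
    by (rule infsum_reindex_bij_betw [OF bij])
  also have "\<dots> = \<tau> ^ k * eisenstein k \<tau>"
    unfolding eisenstein_def by (rule infsum_cmult_right')
  finally show ?thesis .
qed

text \<open>Both sides sum d^j q^(m d) over pairs of positive integers; the right one groups them by
  the product n = m d, so that d runs over the divisors of n.\<close>

lemma lambert_series:
  assumes \<tau>: "\<tau> \<in> upper_half_plane"
  shows "(\<Sum>m. qseries (\<lambda>n. of_nat (Suc n) ^ j) (of_nat (Suc m) * \<tau>)) =
         qseries (\<lambda>n. of_nat (divisor_sigma j (Suc n))) \<tau>"
proof -
  define q where "q = exp (2 * of_real pi * \<i> * \<tau>)"
  have q: "norm q < 1"
    using exp_upper_half_plane [OF \<tau>] by (simp add: q_def)
  \<comment> \<open>In \<open>u\<close> both indices are shifted by one; in \<open>v\<close> only n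
    is, while d is the divisor itself.\<close>
  define u where "u = (\<lambda>(m, d). of_nat (Suc d) ^ j * q ^ (Suc m * Suc d))"
  define v where "v = (\<lambda>(n, d). of_nat d ^ j * q ^ Suc n)"
  define r where "r = norm q"
  have r: "0 \<le> r" "r < 1" using q by (auto simp: r_def)
  define w where "w = (\<lambda>d. real (Suc d) ^ j * r ^ Suc d)"
  have "summable w"
    using norm_summable_qseries [OF disc_summable_of_nat_power \<tau>, of j]
    unfolding exp_of_nat_Suc q_def [symmetric] norm_mult norm_power norm_of_nat w_def r_def .
  then have "w summable_on UNIV"
    by (subst summable_on_UNIV_nonneg_real_iff) (auto simp: w_def r)
  then obtain W where W: "(w has_sum W) UNIV" by (auto simp: summable_on_def)
  have "(\<lambda>m. r ^ m) summable_on UNIV"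
    by (subst summable_on_UNIV_nonneg_real_iff) (use r in auto)
  then have "(\<lambda>(m, d). r ^ m * w d) summable_on (SIGMA m:UNIV. UNIV)"
    by (intro summable_on_SigmaI [where g = "\<lambda>m. r ^ m * W"])
      (use W r in \<open>auto intro!: has_sum_cmult_right summable_on_cmult_left simp: w_def\<close>)
  then have "(\<lambda>(m, d). r ^ m * w d) summable_on UNIV" by simp
  then have "(\<lambda>p. norm (u p)) summable_on UNIV"
  proof (rule summable_on_comparison_test)
    fix p :: "nat \<times> nat"
    obtain m d where p: "p = (m, d)" by (cases p)
    \<comment> \<open>Replacing the product in the exponent by a smaller sum factors the majorant
      into a geometric series in m and the series \<open>w\<close> in d.\<close>
    have "r ^ (Suc m * Suc d) \<le> r ^ (m + Suc d)"
      using r by (intro power_decreasing) auto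
    then have "real (Suc d) ^ j * r ^ (Suc m * Suc d) \<le> real (Suc d) ^ j * r ^ (m + Suc d)"
      by (intro mult_left_mono) auto
    then show "norm (u p) \<le> (case p of (m, d) \<Rightarrow> r ^ m * w d)"
      unfolding p u_def w_def prod.case norm_mult norm_power norm_of_nat r_def [symmetric] power_add
      by (simp only: mult_ac)
  qed auto
  then have u: "u summable_on UNIV" by (rule abs_summable_summable)
  have inner: "qseries (\<lambda>n. of_nat (Suc n) ^ j) (of_nat (Suc m) * \<tau>) = infsum (\<lambda>d. u (m, d)) UNIV" for m
  proof -
    have "Im (of_nat (Suc m) * \<tau>) > 0"
      using \<tau> by (simp add: upper_half_plane_def add_pos_nonneg)
    then have m: "of_nat (Suc m) * \<tau> \<in> upper_half_plane"
      by (simp only: upper_half_plane_def mem_Collect_eq)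
    have e: "exp (2 * of_real pi * \<i> * of_nat (Suc d) * (of_nat (Suc m) * \<tau>)) = q ^ (Suc m * Suc d)" for d
      unfolding q_def by (simp only: exp_of_nat_mult [symmetric] of_nat_mult mult_ac)
    show ?thesis
      using norm_summable_qseries [OF disc_summable_of_nat_power m, of j]
        norm_summable_imp_has_sum [OF _ summable_sums [OF summable_qseries [OF disc_summable_of_nat_power m, of j]]]
      unfolding qseries_def e u_def by (auto simp: infsumI)
  qed
  have "(\<lambda>m. infsum (\<lambda>d. u (m, d)) UNIV) summable_on UNIV"
    using summable_on_Sigma_banach [of "\<lambda>m d. u (m, d)" UNIV "\<lambda>_. UNIV"] u by simp
  then have "(\<Sum>m. infsum (\<lambda>d. u (m, d)) UNIV) = infsum (\<lambda>m. infsum (\<lambda>d. u (m, d)) UNIV) UNIV"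
    by (intro sums_unique [symmetric] has_sum_imp_sums has_sum_infsum)
  also have "\<dots> = infsum u UNIV"
    using infsum_Sigma_banach [of u UNIV "\<lambda>_. UNIV"] u by simp
  finally have lhs: "(\<Sum>m. qseries (\<lambda>n. of_nat (Suc n) ^ j) (of_nat (Suc m) * \<tau>)) = infsum u UNIV"
    by (simp only: inner)
  define T where "T = (SIGMA n:UNIV. {d. d dvd Suc n})"
  have v: "(v has_sum infsum u UNIV) T"
  proof (subst has_sum_reindex_bij_witness [symmetric, where T = T and h = v and S = UNIV and g = u
        and j = "\<lambda>(m, d). (Suc m * Suc d - 1, Suc d)" and i = "\<lambda>(n, d). (Suc n div d - 1, d - 1)"])
    show "(u has_sum infsum u UNIV) UNIV" using u by (rule has_sum_infsum)
  next
    fix p assume "p \<in> T"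
    then obtain n d where p: "p = (n, d)" "d dvd Suc n" by (auto simp: T_def)
    then obtain e where e: "Suc n = d * e" by (auto elim: dvdE)
    then have "d > 0" "e > 0" by (auto intro: Nat.gr0I)
    with e show "(case case p of (n, d) \<Rightarrow> (Suc n div d - 1, d - 1) of (m, d) \<Rightarrow> (Suc m * Suc d - 1, Suc d)) = p"
      unfolding p by (simp add: mult.commute del: mult_Suc mult_Suc_right)
  qed (auto simp: T_def u_def v_def simp del: mult_Suc mult_Suc_right power_Suc)
  have "(\<lambda>(n, d). v (n, d)) summable_on T" using v by (auto simp: summable_on_def)
  then have vs: "(\<lambda>n. infsum (\<lambda>d. v (n, d)) {d. d dvd Suc n}) summable_on UNIV"
    and vi: "infsum (\<lambda>n. infsum (\<lambda>d. v (n, d)) {d. d dvd Suc n}) UNIV = infsum u UNIV"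
    using summable_on_Sigma_banach [of "\<lambda>n d. v (n, d)" UNIV "\<lambda>n. {d. d dvd Suc n}"]
      infsum_Sigma_banach [of v UNIV "\<lambda>n. {d. d dvd Suc n}"] v
    unfolding T_def by (auto simp: infsumI)
  have "infsum (\<lambda>d. v (n, d)) {d. d dvd Suc n} = of_nat (divisor_sigma j (Suc n)) * q ^ Suc n" for n
    by (simp add: divisor_sigma_def v_def sum_distrib_right)
  then have "infsum u UNIV = (\<Sum>n. of_nat (divisor_sigma j (Suc n)) * q ^ Suc n)"
    using sums_unique [OF has_sum_imp_sums [OF has_sum_infsum [OF vs]]] vi by simp
  then show ?thesis
    unfolding lhs by (simp only: qseries_def exp_of_nat_Suc q_def)
qed

text \<open>Summation by rows: row 0 is 2 zeta(k), rows m and -m agree, and row m > 0 is the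
  Lipschitz formula at m \<tau>. The Lambert identity then collects the rows.\<close>

lemma eisenstein_eq_qseries:
  assumes \<tau>: "\<tau> \<in> upper_half_plane" and j: "odd j" "j \<ge> 3"
  shows "eisenstein (Suc j) \<tau> = 2 * (2 * of_real pi * \<i>) ^ Suc j / fact j *
    (qseries (\<lambda>n. of_nat (divisor_sigma j (Suc n))) \<tau> - of_real (bernoulli (Suc j)) / (2 * of_nat (Suc j)))"
proof -
  define k where "k = Suc j"
  define K where "K = (2 * of_real pi * \<i>) ^ k / fact j"
  have k: "even k" "k \<ge> 4" using j by (auto simp: k_def)
  define f where "f = (\<lambda>(m :: int, n :: int). inverse ((of_int m * \<tau> + of_int n) ^ k))"
  have f: "f summable_on UNIV" unfolding f_def by (rule eisenstein_summable [OF \<tau> k(2)])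
  define g where "g = (\<lambda>m. infsum (\<lambda>n. f (m, n)) UNIV)"
  have g: "g summable_on UNIV"
    unfolding g_def using summable_on_Sigma_banach [of "\<lambda>m d. f (m, d)" UNIV "\<lambda>_. UNIV"] f by simp
  have "eisenstein k \<tau> = infsum g UNIV"
    using infsum_Sigma_banach [of f UNIV "\<lambda>_. UNIV"] f unfolding g_def eisenstein_def f_def [symmetric] by simp
  also have "\<dots> = (\<Sum>n. g (int n)) + (\<Sum>n. g (- int (Suc n)))"
    by (rule infsum_int_split(3) [OF g])
  also have "(\<Sum>n. g (int n)) = g 0 + (\<Sum>n. g (int (Suc n)))"
    using suminf_split_head [OF infsum_int_split(1) [OF g]] by simp
  also have "(\<lambda>n. g (- int (Suc n))) = (\<lambda>n. g (int (Suc n)))"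
  proof
    fix n
    have "bij (uminus :: int \<Rightarrow> int)" by (rule bij_uminus)
    from infsum_reindex_bij_betw [OF this, of "\<lambda>i. f (- int (Suc n), i)"]
    have "g (- int (Suc n)) = infsum (\<lambda>i. f (- int (Suc n), - i)) UNIV"
      by (simp add: g_def)
    \<comment> \<open>Negating both coordinates changes nothing, because k is even.\<close>
    also have "(\<lambda>i. f (- int (Suc n), - i)) = (\<lambda>i. f (int (Suc n), i))"
    proof
      fix i
      have "of_int (- int (Suc n)) * \<tau> + of_int (- i) = - (of_int (int (Suc n)) * \<tau> + of_int i)"
        by (simp add: algebra_simps)
      then show "f (- int (Suc n), - i) = f (int (Suc n), i)"
        using k(1) by (simp only: f_def prod.case uminus_power_if if_True)
    qed
    finally show "g (- int (Suc n)) = g (int (Suc n))" by (simp only: g_def)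
  qed
  finally have E: "eisenstein k \<tau> = g 0 + 2 * (\<Sum>n. g (int (Suc n)))" by simp
  have slice: "(\<lambda>n. f (m, n)) summable_on UNIV" for m
  proof -
    have "f summable_on ({m} \<times> UNIV)"
      using f by (rule summable_on_subset_banach) simp
    also have "{m} \<times> UNIV = range (\<lambda>n. (m, n))" by auto
    finally show ?thesis
      by (subst (asm) summable_on_reindex) (auto simp: inj_on_def o_def)
  qed
  have gm: "g m = (\<Sum>n. f (m, int n)) + (\<Sum>n. f (m, - int (Suc n)))" for m
    unfolding g_def by (rule infsum_int_split(3) [OF slice])
  have g_pos: "g (int (Suc m)) = K * qseries (\<lambda>n. of_nat (Suc n) ^ j) (of_nat (Suc m) * \<tau>)" for m
  proof -
    have "Im (of_nat (Suc m) * \<tau>) > 0"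
      using \<tau> by (simp add: upper_half_plane_def add_pos_nonneg)
    then have "of_nat (Suc m) * \<tau> \<in> upper_half_plane"
      by (simp only: upper_half_plane_def mem_Collect_eq)
    from Lipschitz_formula [OF this j(1)] show ?thesis
      by (simp only: gm K_def f_def k_def prod.case of_int_minus of_int_of_nat_eq diff_conv_add_uminus)
  qed
  have "summable (\<lambda>n. f (0, int n))"
    by (rule infsum_int_split(1) [OF slice])
  \<comment> \<open>The origin contributes \<open>inverse 0 = 0\<close>, so the sum may start at n =
    1.\<close>
  from suminf_split_head [OF this] have "(\<Sum>n. f (0, int n)) = (\<Sum>n. f (0, int (Suc n)))"
    using k by (simp add: f_def)
  moreover have "f (0, - int (Suc n)) = f (0, int (Suc n))" for n
    unfolding f_def prod.case of_int_minus of_int_0 mult_zero_left add_0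
    using k(1) by (simp only: uminus_power_if if_True)
  ultimately have "g 0 = 2 * (\<Sum>n. inverse (of_nat (Suc n) ^ k))"
    by (simp add: gm f_def del: of_nat_Suc)
  also have "\<dots> = 2 * K * - (of_real (bernoulli k) / (2 * of_nat k))"
    unfolding k_def zeta_even_bernoulli [OF j(1)] K_def
    by (simp add: field_simps del: of_nat_Suc power_Suc)
  finally have g0: "g 0 = 2 * K * - (of_real (bernoulli k) / (2 * of_nat k))" .
  have "summable (\<lambda>n. g (int (Suc n)))"
    using infsum_int_split(1) [OF g] by (simp only: summable_Suc_iff [of "\<lambda>n. g (int n)"])
  then have "summable (\<lambda>m. K * qseries (\<lambda>n. of_nat (Suc n) ^ j) (of_nat (Suc m) * \<tau>))"
    by (simp only: g_pos)
  moreover have "K \<noteq> 0" by (simp add: K_def)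
  ultimately have s: "summable (\<lambda>m. qseries (\<lambda>n. of_nat (Suc n) ^ j) (of_nat (Suc m) * \<tau>))"
    by (simp only: summable_cmult_iff) simp
  have "(\<Sum>n. g (int (Suc n))) = K * qseries (\<lambda>n. of_nat (divisor_sigma j (Suc n))) \<tau>"
    unfolding g_pos suminf_mult [OF s] lambert_series [OF \<tau>] ..
  with E g0 have "eisenstein k \<tau> = 2 * K *
      (qseries (\<lambda>n. of_nat (divisor_sigma j (Suc n))) \<tau> - of_real (bernoulli k) / (2 * of_nat k))"
    by (simp only:) (simp add: algebra_simps)
  then show ?thesis
    by (simp only: K_def k_def times_divide_eq_right)
qed

text \<open>The inversion of \<open>eisenstein\<close>, with the nonzero factor in front of its
  q-expansion cancelled.\<close>

lemma divisor_qseries_inversion: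
  assumes \<tau>: "\<tau> \<in> upper_half_plane" and k: "even k" "k \<ge> 4"
  defines "S \<equiv> qseries (\<lambda>n. of_nat (divisor_sigma (k - 1) (Suc n)))"
  shows "S (- 1 / \<tau>) - of_real (bernoulli k) / (2 * of_nat k) =
         \<tau> ^ k * (S \<tau> - of_real (bernoulli k) / (2 * of_nat k))"
proof -
  obtain j where j: "k = Suc j" using k by (cases k) auto
  with k have j': "odd j" "j \<ge> 3" by auto
  have nz: "2 * (2 * of_real pi * \<i>) ^ Suc j / fact j \<noteq> (0 :: complex)" by simp
  have "\<tau> \<noteq> 0" using \<tau> by auto
  from eisenstein_inversion [OF this, of k]
  have "2 * (2 * of_real pi * \<i>) ^ Suc j / fact j * (S (- 1 / \<tau>) - of_real (bernoulli k) / (2 * of_nat k)) =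
      2 * (2 * of_real pi * \<i>) ^ Suc j / fact j * (\<tau> ^ k * (S \<tau> - of_real (bernoulli k) / (2 * of_nat k)))"
    unfolding j eisenstein_eq_qseries [OF \<tau> j'] S_def diff_Suc_1
      eisenstein_eq_qseries [OF minus_inverse_upper_half_plane [OF \<tau>] j']
    by (simp only: mult_ac)
  then show ?thesis by (simp only: mult_left_cancel [OF nz])
qed

section \<open>Repeated integration\<close>

lemma higher_deriv_primitive:
  assumes F: "\<And>w. w \<in> S \<Longrightarrow> (F has_field_derivative f w) (at w)"
    and f: "f holomorphic_on S" and S: "open S" and z: "z \<in> S"
  shows "(deriv ^^ Suc n) F z = (deriv ^^ n) f z"
proof -
  have "F holomorphic_on S" using F S by (auto simp: holomorphic_on_open)
  then have "deriv F holomorphic_on S" using S by (rule holomorphic_deriv)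
  from higher_deriv_transform_within_open [OF this f S z] F show ?thesis
    by (simp add: DERIV_imp_deriv funpow_swap1)
qed

text \<open>There are at most n divisors, each at most n. This crude bound already keeps the
  coefficients of \<open>phi\<close> below 1.\<close>

lemma divisor_sigma_le:
  assumes "n > 0"
  shows "divisor_sigma m n \<le> n ^ Suc m"
proof -
  have sub: "{d. d dvd n} \<subseteq> {1..n}"
    using assms by (auto dest: dvd_imp_le intro: Nat.gr0I simp: Suc_le_eq)
  have "divisor_sigma m n \<le> of_nat (card {d. d dvd n}) * n ^ m"
    unfolding divisor_sigma_def
    by (rule sum_bounded_above) (use assms in \<open>auto intro!: power_mono dest: dvd_imp_le\<close>)
  also have "\<dots> \<le> n * n ^ m"
    using card_mono [OF _ sub] by simp
  finally show ?thesis by simp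
qed

section \<open>The coefficients of \<open>phi\<close> and its (k+1)-st derivative\<close>

abbreviation phi_coeff :: "nat \<Rightarrow> nat \<Rightarrow> complex" where
  "phi_coeff k n \<equiv> of_nat (divisor_sigma (k - 1) (Suc n)) / of_nat (Suc n) ^ (k + 1)"

lemma phi_eq_qseries: "phi k = qseries (phi_coeff k)"
  by (rule ext) (simp only: phi_def qseries_def)

lemma disc_summable_phi_coeff:
  assumes "k > 0"
  shows "disc_summable (phi_coeff k)"
proof (rule disc_summable_bounded)
  fix n
  have "divisor_sigma (k - 1) (Suc n) \<le> Suc n ^ Suc (k - 1)"
    by (rule divisor_sigma_le) simp
  also have "\<dots> \<le> Suc n ^ (k + 1)" using assms by (intro power_increasing) auto
  finally have "real (divisor_sigma (k - 1) (Suc n)) \<le> real (Suc n) ^ (k + 1)"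
    by (simp only: of_nat_le_iff flip: of_nat_power)
  then show "norm (phi_coeff k n) \<le> 1"
    unfolding norm_divide norm_power norm_of_nat by (subst divide_le_eq_1_pos) auto
qed

text \<open>Each derivative multiplies the n-th coefficient by 2 pi i n, so k + 1 of them clear the
  denominator n^(k+1).\<close>

lemma higher_deriv_phi:
  assumes "\<tau> \<in> upper_half_plane" and "k > 0"
  shows "(deriv ^^ Suc k) (phi k) \<tau> =
    (2 * of_real pi * \<i>) ^ Suc k * qseries (\<lambda>n. of_nat (divisor_sigma (k - 1) (Suc n))) \<tau>"
proof -
  have eq: "(2 * of_real pi * \<i> * of_nat (Suc n)) ^ Suc k * phi_coeff k n =
      (2 * of_real pi * \<i>) ^ Suc k * of_nat (divisor_sigma (k - 1) (Suc n))" for n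
    unfolding power_mult_distrib by (simp del: of_nat_Suc)
  \<comment> \<open>Convergence of the divisor series is inherited from the differentiated
    \<open>phi\<close>, scaled back.\<close>
  have "disc_summable (\<lambda>n. (1 / (2 * of_real pi * \<i>) ^ Suc k) *
      ((2 * of_real pi * \<i> * of_nat (Suc n)) ^ Suc k * phi_coeff k n))"
    by (intro disc_summable_cmult disc_summable_power disc_summable_phi_coeff assms)
  then have "disc_summable (\<lambda>n. of_nat (divisor_sigma (k - 1) (Suc n)))"
    unfolding eq by simp
  from suminf_mult [OF summable_qseries [OF this assms(1)], of "(2 * of_real pi * \<i>) ^ Suc k"]
  show ?thesis
    unfolding phi_eq_qseries higher_deriv_qseries [OF disc_summable_phi_coeff [OF assms(2)] assms(1)] eq
    by (simp only: qseries_def mult.assoc)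
qed

text \<open>The kernel \<open>t ^ k * (k * (k + 1) * \<tau> - (k + 1) * (k + 2) * t)\<close> is the one for which all
  derivatives of \<open>t ^ k * f (- 1 / t)\<close> but the highest cancel.\<close>

lemma higher_deriv_period_integral:
  fixes k :: nat
  assumes G: "G holomorphic_on S" and S: "open S" and \<tau>: "\<tau> \<in> S" and k: "k > 0"
    and F0: "\<And>w. w \<in> S \<Longrightarrow> (F0 has_field_derivative G w) (at w)"
    and F1: "\<And>w. w \<in> S \<Longrightarrow> (F1 has_field_derivative w * G w) (at w)"
  shows "(deriv ^^ Suc k) (\<lambda>w. w * (w * G w) + of_nat (k * (k + 1)) * (w * F0 w)
           - of_nat ((k + 1) * (k + 2)) * F1 w) \<tau> = \<tau>\<^sup>2 * (deriv ^^ Suc k) G \<tau>"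
proof -
  obtain j where j: "k = Suc j" using k by (cases k) auto
  let ?D = "\<lambda>n. (deriv ^^ n)"
  have wG: "(\<lambda>w. w * G w) holomorphic_on S" using G by (intro holomorphic_intros)
  have hF: "F0 holomorphic_on S" "F1 holomorphic_on S"
    using F0 F1 S by (auto simp: holomorphic_on_open)
  note mult = higher_deriv_ident_mult [OF _ S \<tau>]
  have 1: "?D (Suc k) (\<lambda>w. w * (w * G w)) \<tau> =
      \<tau> * (\<tau> * ?D (Suc k) G \<tau> + of_nat (Suc k) * ?D k G \<tau>)
      + of_nat (Suc k) * (\<tau> * ?D k G \<tau> + of_nat k * ?D j G \<tau>)"
    by (simp only: mult [OF wG] mult [OF G] diff_Suc_1 j)
  have 2: "?D (Suc k) (\<lambda>w. w * F0 w) \<tau> = \<tau> * ?D k G \<tau> + of_nat (Suc k) * ?D j G \<tau>"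
    by (simp only: mult [OF hF(1)] diff_Suc_1 higher_deriv_primitive [OF F0 G S \<tau>] j)
  have 3: "?D (Suc k) F1 \<tau> = \<tau> * ?D k G \<tau> + of_nat k * ?D j G \<tau>"
    by (simp only: higher_deriv_primitive [OF F1 wG S \<tau>] mult [OF G] diff_Suc_1 j)
  \<comment> \<open>The lower terms cancel by two linear conditions that fix both constants: 2(k+1)
    + k(k+1) - (k+1)(k+2) = 0 at \<tau> times the k-th derivative, and k(k+1) (1 + (k+1) - (k+2)) =
    0 at the (k-1)-st.\<close>
  have "?D (Suc k) (\<lambda>w. w * (w * G w) + of_nat (k * (k + 1)) * (w * F0 w)
      - of_nat ((k + 1) * (k + 2)) * F1 w) \<tau> =
    ?D (Suc k) (\<lambda>w. w * (w * G w)) \<tau> + of_nat (k * (k + 1)) * ?D (Suc k) (\<lambda>w. w * F0 w) \<tau>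
      - of_nat ((k + 1) * (k + 2)) * ?D (Suc k) F1 \<tau>"
    by (subst higher_deriv_diff [OF _ _ S \<tau>] higher_deriv_add [OF _ _ S \<tau>] higher_deriv_cmult [OF _ \<tau> S];
        (intro G hF holomorphic_intros)?)+ (rule refl)
  also have "\<dots> = \<tau>\<^sup>2 * ?D (Suc k) G \<tau>"
    unfolding 1 2 3 by (simp del: funpow.simps add: algebra_simps power2_eq_square)
  finally show ?thesis .
qed

section \<open>The difference of the two sides as a polynomial\<close>

theorem theorem5p1:
  fixes k :: nat and \<alpha> :: complex
  assumes "k \<ge> 4" and "even k" and "\<alpha> \<in> upper_half_plane"
  shows "\<exists>(P :: complex poly) (Q :: complex poly poly).
           degree P \<le> k + 1 \<and> total_degree Q \<le> k + 1 \<and>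
           (\<forall>\<tau>\<in>upper_half_plane.
              phi k \<tau> = \<tau> ^ (k + 2) * phi k (- 1 / \<tau>)
                        - of_nat k / C_const k * \<tau> * Ln \<tau>
                        + poly P \<tau>
                        + contour_integral (linepath \<alpha> \<tau>)
                            (\<lambda>t. poly2 Q t \<tau> * phi k (- 1 / t)))"
proof -
  let ?H = upper_half_plane
  note S = open_upper_half_plane
  have k: "k > 0" using assms(1) by simp
  define c :: complex where "c = 2 * of_real pi * \<i>"
  define \<beta> :: complex where "\<beta> = of_real (bernoulli k) / (2 * of_nat k)"
  define a where "a = - (of_nat k / C_const k)"
  have a: "a * fact (k - 1) = c ^ Suc k * \<beta>"
  proof -
    have "fact k = of_nat k * (fact (k - 1) :: complex)" using k by (rule fact_reduce)
    then show ?thesis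
      using k by (simp add: a_def C_const_def c_def \<beta>_def field_simps)
  qed
  define G where "G = (\<lambda>t. t ^ k * phi k (- 1 / t))"
  have phi: "phi k holomorphic_on ?H"
    unfolding phi_eq_qseries by (rule holomorphic_qseries [OF disc_summable_phi_coeff [OF k]])
  have "(\<lambda>t. phi k (- 1 / t)) holomorphic_on ?H"
    by (rule holomorphic_on_compose_gen [OF _ phi, unfolded o_def])
      (auto intro!: holomorphic_intros minus_inverse_upper_half_plane [simplified])
  then have G: "G holomorphic_on ?H" unfolding G_def by (intro holomorphic_intros)
  \<comment> \<open>Normalising at \<alpha> makes the value at \<tau> equal to the contour integral
    from \<alpha> to \<tau>.\<close>
  have primitive: "\<exists>F. F \<alpha> = 0 \<and> (\<forall>z\<in>?H. (F has_field_derivative f z) (at z))"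
    if f: "f holomorphic_on ?H" for f
  proof -
    obtain F where F: "\<And>z. z \<in> ?H \<Longrightarrow> (F has_field_derivative f z) (at z within ?H)"
      using holomorphic_convex_primitive' [OF convex_upper_half_plane S f] by blast
    have "((\<lambda>z. F z - F \<alpha>) has_field_derivative f z) (at z)" if "z \<in> ?H" for z
      using DERIV_diff [OF F [OF that] DERIV_const [of "F \<alpha>"]] at_within_open [OF that S] by simp
    then show ?thesis by (intro exI [of _ "\<lambda>z. F z - F \<alpha>"]) auto
  qed
  obtain F0 where F0: "F0 \<alpha> = 0" "\<And>z. z \<in> ?H \<Longrightarrow> (F0 has_field_derivative G z) (at z)"
    using primitive [OF G] by blast
  have "(\<lambda>z. z * G z) holomorphic_on ?H" using G by (intro holomorphic_intros)
  from primitive [OF this]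
  obtain F1 where F1: "F1 \<alpha> = 0" "\<And>z. z \<in> ?H \<Longrightarrow> (F1 has_field_derivative z * G z) (at z)"
    by blast
  \<comment> \<open>The term \<tau>^(k+2) phi(-1/\<tau>) is \<tau>^2 G(\<tau>). Together with the
    integral it becomes a function of one variable, to which the derivative rules apply.\<close>
  define I where "I = (\<lambda>w. w * (w * G w) + of_nat (k * (k + 1)) * (w * F0 w)
           - of_nat ((k + 1) * (k + 2)) * F1 w)"
  have I: "I holomorphic_on ?H"
  proof -
    have "F0 holomorphic_on ?H" "F1 holomorphic_on ?H"
      using F0(2) F1(2) S by (auto simp: holomorphic_on_open)
    then show ?thesis unfolding I_def using G by (intro holomorphic_intros)
  qed
  define R where "R = (\<lambda>w. phi k w - (I w + a * (w * Ln w)))"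
  have L: "(\<lambda>w. w * Ln w) holomorphic_on ?H"
    by (intro holomorphic_intros holomorphic_Ln_upper_half_plane)
  have R: "R holomorphic_on ?H"
    unfolding R_def by (intro L phi I holomorphic_intros)
  have R_const: "(deriv ^^ Suc k) R \<tau> = c ^ Suc k * \<beta>" if \<tau>: "\<tau> \<in> ?H" for \<tau>
  proof -
    have \<tau>0: "\<tau> \<noteq> 0" using \<tau> by auto
    define s where "s = qseries (\<lambda>n. of_nat (divisor_sigma (k - 1) (Suc n)))"
    have "(deriv ^^ Suc k) R \<tau> = (deriv ^^ Suc k) (phi k) \<tau>
        - ((deriv ^^ Suc k) I \<tau> + a * (deriv ^^ Suc k) (\<lambda>w. w * Ln w) \<tau>)"
      unfolding R_def
      by (subst higher_deriv_diff [OF _ _ S \<tau>] higher_deriv_add [OF _ _ S \<tau>] higher_deriv_cmult [OF _ \<tau> S];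
        (intro L phi I holomorphic_intros)?)+ (rule refl)
    also have "(deriv ^^ Suc k) I \<tau> = \<tau>\<^sup>2 * (deriv ^^ Suc k) G \<tau>"
      unfolding I_def by (rule higher_deriv_period_integral [OF G S \<tau> k F0(2) F1(2)])
    also have "(deriv ^^ Suc k) G \<tau> = (deriv ^^ Suc k) (phi k) (- 1 / \<tau>) / \<tau> ^ (k + 2)"
      unfolding G_def by (rule higher_deriv_inversion [OF phi \<tau>])
    also have "(deriv ^^ Suc k) (phi k) (- 1 / \<tau>) = c ^ Suc k * s (- 1 / \<tau>)"
      unfolding c_def s_def by (rule higher_deriv_phi [OF minus_inverse_upper_half_plane [OF \<tau>] k])
    also have "s (- 1 / \<tau>) = \<tau> ^ k * (s \<tau> - \<beta>) + \<beta>"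
      using divisor_qseries_inversion [OF \<tau> assms(2,1)] unfolding s_def \<beta>_def
      by (simp only: diff_eq_eq)
    also have "(deriv ^^ Suc k) (phi k) \<tau> = c ^ Suc k * s \<tau>"
      unfolding c_def s_def by (rule higher_deriv_phi [OF \<tau> k])
    \<comment> \<open>The sign is (-1)^(k-1) = -1, as k is even.\<close>
    also have "(deriv ^^ Suc k) (\<lambda>w. w * Ln w) \<tau> = - (fact (k - 1) / \<tau> ^ k)"
      using higher_deriv_mult_Ln [OF \<tau> k] assms(2) k by simp
    also have "a * - (fact (k - 1) / \<tau> ^ k) = - (c ^ Suc k * \<beta> / \<tau> ^ k)"
      unfolding a [symmetric] by simp
    finally show ?thesis
      unfolding power_add using \<tau>0 by (simp add: field_simps power2_eq_square)
  qed
  \<comment> \<open>The (k+1)-st derivative is only constant; one more derivative kills it, whence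
    degree k + 1 and not k.\<close>
  have R_0: "(deriv ^^ Suc (Suc k)) R \<tau> = 0" if \<tau>: "\<tau> \<in> ?H" for \<tau>
  proof -
    have "((deriv ^^ Suc k) R has_field_derivative 0) (at \<tau>)"
      by (rule has_field_derivative_transform_within_open [OF DERIV_const S \<tau> R_const [symmetric]])
    from DERIV_imp_deriv [OF this] show ?thesis by simp
  qed
  obtain P where P: "degree P \<le> Suc k" "\<And>z. z \<in> ?H \<Longrightarrow> R z = poly P z"
    using polynomial_if_higher_deriv_eq_0 [OF R S convex_connected [OF convex_upper_half_plane] R_0] by blast
  define Q :: "complex poly poly" where
    \<comment> \<open>The outer list runs over powers of \<tau>: the kernel is linear in \<tau>, and
      both of its terms have total degree k + 1.\<close>
    "Q = [: monom (- of_nat ((k + 1) * (k + 2))) (k + 1), monom (of_nat (k * (k + 1))) k :]"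
  have Q: "poly2 Q t \<tau> = t ^ k * (of_nat (k * (k + 1)) * \<tau> - of_nat ((k + 1) * (k + 2)) * t)" for t \<tau>
    by (simp only: poly2_def Q_def poly_pCons poly_0 poly_add poly_mult poly_monom) (simp add: algebra_simps)
  have "total_degree Q \<le> k + 1"
    unfolding total_degree_def
  proof (rule Max.boundedI)
    fix d assume "d \<in> (\<lambda>i. i + degree (coeff Q i)) ` {..degree Q}"
    then obtain i where i: "i \<le> degree Q" "d = i + degree (coeff Q i)" by auto
    have "degree Q \<le> 1" by (simp add: Q_def)
    with i(1) have "i = 0 \<or> i = 1" by auto
    then show "d \<le> k + 1"
      unfolding i(2) Q_def
      by (auto intro: order.trans [OF degree_monom_le])
  qed auto
  moreover have "phi k \<tau> = \<tau> ^ (k + 2) * phi k (- 1 / \<tau>) - of_nat k / C_const k * \<tau> * Ln \<tau> + poly P \<tau>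
      + contour_integral (linepath \<alpha> \<tau>) (\<lambda>t. poly2 Q t \<tau> * phi k (- 1 / t))" if \<tau>: "\<tau> \<in> ?H" for \<tau>
  proof -
    have sub: "path_image (linepath \<alpha> \<tau>) \<subseteq> ?H"
      using closed_segment_subset [OF assms(3) \<tau> convex_upper_half_plane] by simp
    have "(G has_contour_integral F0 \<tau>) (linepath \<alpha> \<tau>)"
      using contour_integral_primitive [OF has_field_derivative_at_within [OF F0(2)] valid_path_linepath sub] F0(1)
      by simp
    moreover have "((\<lambda>t. t * G t) has_contour_integral F1 \<tau>) (linepath \<alpha> \<tau>)"
      using contour_integral_primitive [OF has_field_derivative_at_within [OF F1(2)] valid_path_linepath sub] F1(1)
      by simp
    ultimately have "((\<lambda>t. of_nat (k * (k + 1)) * \<tau> * G t - of_nat ((k + 1) * (k + 2)) * (t * G t)) has_contour_integral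
        of_nat (k * (k + 1)) * \<tau> * F0 \<tau> - of_nat ((k + 1) * (k + 2)) * F1 \<tau>) (linepath \<alpha> \<tau>)"
      by (intro has_contour_integral_diff has_contour_integral_lmul)
    also have "(\<lambda>t. of_nat (k * (k + 1)) * \<tau> * G t - of_nat ((k + 1) * (k + 2)) * (t * G t)) =
        (\<lambda>t. poly2 Q t \<tau> * phi k (- 1 / t))"
      unfolding Q G_def by (simp add: algebra_simps)
    finally have int: "contour_integral (linepath \<alpha> \<tau>) (\<lambda>t. poly2 Q t \<tau> * phi k (- 1 / t)) =
        of_nat (k * (k + 1)) * \<tau> * F0 \<tau> - of_nat ((k + 1) * (k + 2)) * F1 \<tau>"
      by (rule contour_integral_unique)
    have G\<tau>: "\<tau> ^ (k + 2) * phi k (- 1 / \<tau>) = \<tau> * (\<tau> * G \<tau>)"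
      by (simp add: G_def)
    have "phi k \<tau> = I \<tau> + a * (\<tau> * Ln \<tau>) + poly P \<tau>"
      using P(2) [OF \<tau>] by (simp add: R_def algebra_simps)
    then show ?thesis
      unfolding int G\<tau> I_def a_def by simp
  qed
  ultimately show ?thesis using P(1) by auto
qed

end
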